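(* Let $\mathbb F$ be a field, let $0\neq q\in\mathbb F$ be not a root of unity, let $\mathcal U^+_q$ be the alternating central extension of $U^+_q$, and put $\xi=-q^2(q-q^{-1})^{-2}$. Then the following identities of generating functions hold over $\mathcal U^+_q$: $$E^-(t) = \mathcal W^-(q^{-1} \xi^{-1} t) \bigl( \mathcal {\tilde G}(q^{-1} \xi^{-1} t)\bigr)^{-1},$$ $$E^+(t) = \mathcal W^+(q \xi^{-1} t) \bigl( \mathcal {\tilde G}(q \xi^{-1} t)\bigr)^{-1},$$ $$E(t) = -\,\frac{\mathcal Z^\vee(\xi^{-1}t) \bigl( \mathcal {\tilde G}(q^{-1} \xi^{-1} t)\bigr)^{-1} \bigl( \mathcal {\tilde G}(q \xi^{-1} t)\bigr)^{-1}}{q-q^{-1}}.$$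
   Context: Algebras are associative, unital, over $\mathbb F$. For elements $X,Y$ of an algebra and $0\ne p\in\mathbb F$: $[X,Y]=XY-YX$, $[X,Y]_p=pXY-p^{-1}YX$. $\mathbb N=\{0,1,2,\ldots\}$. Generating functions over an algebra $\mathcal A$ are formal power series with coefficients in $\mathcal A$ in an indeterminate $t$ commuting with $\mathcal A$; $\sum_n a_nt^n$ is invertible iff $a_0$ is invertible. The algebra $\mathcal U^+_q$ is defined by generators $\{\mathcal W_{-k}\}_{k\in\mathbb N}$, $\{\mathcal W_{k+1}\}_{k\in\mathbb N}$, $\{\mathcal G_{k+1}\}_{k\in\mathbb N}$, $\{\mathcal{\tilde G}_{k+1}\}_{k\in\mathbb N}$ (called alternating) and the relations, for all $k,\ell\in\mathbb N$: $[\mathcal W_0,\mathcal W_{k+1}]=[\mathcal W_{-k},\mathcal W_1]=(1-q^{-2})(\mathcal{\tilde G}_{k+1}-\mathcal G_{k+1})$; $[\mathcal W_0,\mathcal G_{k+1}]_q=[\mathcal{\tilde G}_{k+1},\mathcal W_0]_q=(q-q^{-1})\mathcal W_{-k-1}$; $[\mathcal G_{k+1},\mathcal W_1]_q=[\mathcal W_1,\mathcal{\tilde G}_{k+1}]_q=(q-q^{-1})\mathcal W_{k+2}$; $[\mathcal W_{-k},\mathcal W_{-\ell}]=0$, $[\mathcal W_{k+1},\mathcal W_{\ell+1}]=0$; $[\mathcal W_{-k},\mathcal W_{\ell+1}]+[\mathcal W_{k+1},\mathcal W_{-\ell}]=0$; $[\mathcal W_{-k},\mathcal G_{\ell+1}]+[\mathcal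 G_{k+1},\mathcal W_{-\ell}]=0$; $[\mathcal W_{-k},\mathcal{\tilde G}_{\ell+1}]+[\mathcal{\tilde G}_{k+1},\mathcal W_{-\ell}]=0$; $[\mathcal W_{k+1},\mathcal G_{\ell+1}]+[\mathcal G_{k+1},\mathcal W_{\ell+1}]=0$; $[\mathcal W_{k+1},\mathcal{\tilde G}_{\ell+1}]+[\mathcal{\tilde G}_{k+1},\mathcal W_{\ell+1}]=0$; $[\mathcal G_{k+1},\mathcal G_{\ell+1}]=0$, $[\mathcal{\tilde G}_{k+1},\mathcal{\tilde G}_{\ell+1}]=0$; $[\mathcal{\tilde G}_{k+1},\mathcal G_{\ell+1}]+[\mathcal G_{k+1},\mathcal{\tilde G}_{\ell+1}]=0$. Put $\mathcal G_0=\mathcal{\tilde G}_0=1$. Set $\mathcal W^-(t)=\sum_{n\in\mathbb N}\mathcal W_{-n}t^n$, $\mathcal W^+(t)=\sum_{n\in\mathbb N}\mathcal W_{n+1}t^n$, $\mathcal G(t)=\sum_{n\in\mathbb N}\mathcal G_nt^n$, $\mathcal{\tilde G}(t)=\sum_{n\in\mathbb N}\mathcal{\tilde G}_nt^n$. Set $\mathcal Z^\vee_0=1$ and, for $n\ge1$, $\mathcal Z^\vee_n=\sum_{k=0}^n\mathcal G_k\mathcal{\tilde G}_{n-k}q^{n-2k}-q\sum_{k=0}^{n-1}\mathcal W_{-k}\mathcal W_{n-k}q^{n-1-2k}$; $\mathcal Z^\vee(t)=\sum_{n\in\mathbb N}\mathcal Z^\vee_nt^n$, equivalently $\mathcal Z^\vee(t)=\mathcal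 G(q^{-1}t)\mathcal{\tilde G}(qt)-qt\,\mathcal W^-(q^{-1}t)\mathcal W^+(qt)$. $U^+_q$ is the algebra with generators $W_0,W_1$ and relations $[W_0,[W_0,[W_0,W_1]_q]_{q^{-1}}]=0$, $[W_1,[W_1,[W_1,W_0]_q]_{q^{-1}}]=0$. There is an injective algebra homomorphism $U^+_q\to\mathcal U^+_q$, $W_0\mapsto\mathcal W_0$, $W_1\mapsto\mathcal W_1$, by which $U^+_q$ is identified with the subalgebra of $\mathcal U^+_q$ generated by $\mathcal W_0,\mathcal W_1$. Damiani's elements of $U^+_q$ (viewed in $\mathcal U^+_q$) are defined recursively by $E_{\alpha_0}=W_0$, $E_{\alpha_1}=W_1$, $E_\delta=q^{-2}W_1W_0-W_0W_1$ and, for $n\ge1$, $E_{n\delta+\alpha_0}=\frac{[E_\delta,E_{(n-1)\delta+\alpha_0}]}{q+q^{-1}}$, $E_{n\delta+\alpha_1}=\frac{[E_{(n-1)\delta+\alpha_1},E_\delta]}{q+q^{-1}}$, $E_{n\delta}=q^{-2}E_{(n-1)\delta+\alpha_1}W_0-W_0E_{(n-1)\delta+\alpha_1}$; also $E_{0\delta}=-(q-q^{-1})^{-1}$. Set $E^-(t)=\sum_{n\in\mathbb N}E_{n\delta+\alpha_0}t^n$, $E^+(t)=\sum_{n\in\mathbb N}E_{n\delta+\alpha_1}t^n$, $E(t)=\sum_{n\in\mathbb N}E_{n\delta}t^n$. *)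

theory Defs
  imports "HOL-Library.Poly_Mapping" "HOL-Algebra.QuotRing" "HOL-Algebra.Module"
begin

section \<open>Algebras given by generators and relations\<close>

datatype 'g word = Word (letters: "'g list")

instantiation word :: (type) monoid_add
begin

definition "0 = Word []"

definition "u + v = Word (letters u @ letters v)"

instance
  by standard (auto simp: zero_word_def plus_word_def word.expand)

end

text \<open>The free associative unital algebra over \<open>'f\<close> on \<open>'g\<close> is the monoid algebra of the free
  monoid of words: \<open>*\<close> on \<open>'g word \<Rightarrow>\<^sub>0 'f\<close> is convolution with respect to concatenation.\<close>

type_synonym ('f, 'g) free_algebra = "'g word \<Rightarrow>\<^sub>0 'f"

definition gen :: "'g \<Rightarrow> ('f::field, 'g) free_algebra"
  where "gen g = Poly_Mapping.single (Word [g]) 1"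

definition scalar :: "'f \<Rightarrow> ('f::field, 'g) free_algebra"
  where "scalar c = Poly_Mapping.single 0 c"

definition free_algebra_ring :: "('f::field, 'g) free_algebra ring"
  where "free_algebra_ring = \<lparr>carrier = UNIV, mult = (*), one = 1, zero = 0, add = (+)\<rparr>"

type_synonym ('f, 'g) relations = "('f, 'g) free_algebra \<Rightarrow> ('f, 'g) free_algebra \<Rightarrow> bool"

definition relation_ideal :: "('f::field, 'g) relations \<Rightarrow> ('f, 'g) free_algebra set"
  where "relation_ideal rel = Idl\<^bsub>free_algebra_ring\<^esub> {a - b | a b. rel a b}"

text \<open>The record type \<open>module\<close> serves here as the signature of a (noncommutative) algebra: a ring
  together with a scalar multiplication. The locale \<open>algebra\<close> of HOL-Algebra is not applicable, since
  it requires the algebra to be commutative.\<close>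

definition presented_algebra ::
    "('f::field, 'g) relations \<Rightarrow> ('f, ('f, 'g) free_algebra set) module"
  where "presented_algebra rel =
    ring.extend (free_algebra_ring Quot relation_ideal rel)
      (module.fields
        (\<lambda>c X. \<Union>x\<in>X. relation_ideal rel +>\<^bsub>free_algebra_ring\<^esub> (scalar c * x)))"

definition presented_gen :: "('f::field, 'g) relations \<Rightarrow> 'g \<Rightarrow> ('f, 'g) free_algebra set"
  where "presented_gen rel g = relation_ideal rel +>\<^bsub>free_algebra_ring\<^esub> gen g"


section \<open>Generating functions over an algebra\<close>

text \<open>The generating function \<open>\<Sum>n. a n * t ^ n\<close> is represented by its coefficient sequence \<open>a\<close>.\<close>

definition series_algebra :: "('f, 'a) module \<Rightarrow> ('f, nat \<Rightarrow> 'a) module"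
  where "series_algebra A =
    \<lparr>carrier = {a. \<forall>n. a n \<in> carrier A},
     mult = (\<lambda>a b n. \<Oplus>\<^bsub>A\<^esub>k\<in>{..n}. a k \<otimes>\<^bsub>A\<^esub> b (n - k)),
     one = (\<lambda>n. if n = 0 then \<one>\<^bsub>A\<^esub> else \<zero>\<^bsub>A\<^esub>),
     zero = (\<lambda>n. \<zero>\<^bsub>A\<^esub>),
     add = (\<lambda>a b n. a n \<oplus>\<^bsub>A\<^esub> b n),
     smult = (\<lambda>c a n. c \<odot>\<^bsub>A\<^esub> a n)\<rparr>"

text \<open>The substitution \<open>a(t) \<mapsto> a(c * t)\<close> for a scalar \<open>c\<close>.\<close>

definition dilate :: "('f::field, 'a) module \<Rightarrow> 'f \<Rightarrow> (nat \<Rightarrow> 'a) \<Rightarrow> nat \<Rightarrow> 'a"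
  where "dilate A c a = (\<lambda>n. c ^ n \<odot>\<^bsub>A\<^esub> a n)"


section \<open>The alternating central extension\<close>

text \<open>\<open>GenW i\<close> is the generator \<open>W\<^sub>i\<close> for an arbitrary integer \<open>i\<close>; the nonpositive indices give
  the \<open>W\<^bsub>-k\<^esub>\<close> and the positive ones the \<open>W\<^bsub>k+1\<^esub>\<close>. The generators \<open>GenG k\<close> and \<open>GenGt k\<close> are
  \<open>G\<^bsub>k+1\<^esub>\<close> and \<open>\<tilde>G\<^bsub>k+1\<^esub>\<close>: the index is shifted by one because
  \<open>G\<^sub>0 = \<tilde>G\<^sub>0 = 1\<close> are not generators.\<close>

datatype alt_gen = GenW int | GenG nat | GenGt nat

abbreviation fW :: "int \<Rightarrow> ('f::field, alt_gen) free_algebra"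
  where "fW i \<equiv> gen (GenW i)"

abbreviation fG :: "nat \<Rightarrow> ('f::field, alt_gen) free_algebra"
  where "fG n \<equiv> (case n of 0 \<Rightarrow> 1 | Suc k \<Rightarrow> gen (GenG k))"

abbreviation fGt :: "nat \<Rightarrow> ('f::field, alt_gen) free_algebra"
  where "fGt n \<equiv> (case n of 0 \<Rightarrow> 1 | Suc k \<Rightarrow> gen (GenGt k))"

definition comm :: "('f::field, 'g) free_algebra \<Rightarrow> ('f, 'g) free_algebra \<Rightarrow> ('f, 'g) free_algebra"
  where "comm X Y = X * Y - Y * X"

definition qcomm ::
    "'f::field \<Rightarrow> ('f, 'g) free_algebra \<Rightarrow> ('f, 'g) free_algebra \<Rightarrow> ('f, 'g) free_algebra"
  where "qcomm p X Y = scalar p * (X * Y) - scalar (inverse p) * (Y * X)"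

inductive alt_rel :: "'f::field \<Rightarrow> ('f, alt_gen) relations" for q :: 'f
  where
  "alt_rel q (comm (fW 0) (fW (int k + 1))) (scalar (1 - q powi (-2)) * (fGt (k + 1) - fG (k + 1)))"
| "alt_rel q (comm (fW (- int k)) (fW 1)) (scalar (1 - q powi (-2)) * (fGt (k + 1) - fG (k + 1)))"
| "alt_rel q (qcomm q (fW 0) (fG (k + 1))) (scalar (q - inverse q) * fW (- int k - 1))"
| "alt_rel q (qcomm q (fGt (k + 1)) (fW 0)) (scalar (q - inverse q) * fW (- int k - 1))"
| "alt_rel q (qcomm q (fG (k + 1)) (fW 1)) (scalar (q - inverse q) * fW (int k + 2))"
| "alt_rel q (qcomm q (fW 1) (fGt (k + 1))) (scalar (q - inverse q) * fW (int k + 2))"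
| "alt_rel q (comm (fW (- int k)) (fW (- int l))) 0"
| "alt_rel q (comm (fW (int k + 1)) (fW (int l + 1))) 0"
| "alt_rel q (comm (fW (- int k)) (fW (int l + 1)) + comm (fW (int k + 1)) (fW (- int l))) 0"
| "alt_rel q (comm (fW (- int k)) (fG (l + 1)) + comm (fG (k + 1)) (fW (- int l))) 0"
| "alt_rel q (comm (fW (- int k)) (fGt (l + 1)) + comm (fGt (k + 1)) (fW (- int l))) 0"
| "alt_rel q (comm (fW (int k + 1)) (fG (l + 1)) + comm (fG (k + 1)) (fW (int l + 1))) 0"
| "alt_rel q (comm (fW (int k + 1)) (fGt (l + 1)) + comm (fGt (k + 1)) (fW (int l + 1))) 0"
| "alt_rel q (comm (fG (k + 1)) (fG (l + 1))) 0"
| "alt_rel q (comm (fGt (k + 1)) (fGt (l + 1))) 0"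
| "alt_rel q (comm (fGt (k + 1)) (fG (l + 1)) + comm (fG (k + 1)) (fGt (l + 1))) 0"

type_synonym 'f alt_elem = "('f, alt_gen) free_algebra set"

definition Uq :: "'f::field \<Rightarrow> ('f, 'f alt_elem) module"
  where "Uq q = presented_algebra (alt_rel q)"

definition W :: "'f::field \<Rightarrow> int \<Rightarrow> 'f alt_elem"
  where "W q i = presented_gen (alt_rel q) (GenW i)"

definition G :: "'f::field \<Rightarrow> nat \<Rightarrow> 'f alt_elem"
  where "G q n = (case n of 0 \<Rightarrow> \<one>\<^bsub>Uq q\<^esub> | Suc k \<Rightarrow> presented_gen (alt_rel q) (GenG k))"

definition Gt :: "'f::field \<Rightarrow> nat \<Rightarrow> 'f alt_elem"
  where "Gt q n = (case n of 0 \<Rightarrow> \<one>\<^bsub>Uq q\<^esub> | Suc k \<Rightarrow> presented_gen (alt_rel q) (GenGt k))"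

definition Zv :: "'f::field \<Rightarrow> nat \<Rightarrow> 'f alt_elem"
  where "Zv q n =
    (if n = 0 then \<one>\<^bsub>Uq q\<^esub>
     else
       (\<Oplus>\<^bsub>Uq q\<^esub>k\<in>{0..n}. q powi (int n - 2 * int k) \<odot>\<^bsub>Uq q\<^esub> (G q k \<otimes>\<^bsub>Uq q\<^esub> Gt q (n - k)))
       \<ominus>\<^bsub>Uq q\<^esub>
       q \<odot>\<^bsub>Uq q\<^esub>
         (\<Oplus>\<^bsub>Uq q\<^esub>k\<in>{0..n - 1}. q powi (int n - 1 - 2 * int k) \<odot>\<^bsub>Uq q\<^esub>
            (W q (- int k) \<otimes>\<^bsub>Uq q\<^esub> W q (int n - int k))))"


section \<open>Damiani's elements\<close>

text \<open>The recursion only involves \<open>W\<^sub>0\<close>, \<open>W\<^sub>1\<close> and the algebra operations. Run in any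
  algebra \<open>A\<close> on elements \<open>X\<close>, \<open>Y\<close>, it gives the images of Damiani's elements under an algebra
  homomorphism from \<open>U\<^sub>q\<^sup>+\<close> to \<open>A\<close> with \<open>W\<^sub>0 \<mapsto> X\<close> and \<open>W\<^sub>1 \<mapsto> Y\<close>.\<close>

context
  fixes A :: "('f::field, 'a) module" (structure) and q :: 'f and X Y :: 'a
begin

definition E_delta1 :: 'a
  where "E_delta1 = (q powi (-2) \<odot> (Y \<otimes> X)) \<ominus> (X \<otimes> Y)"

primrec E_alpha0 :: "nat \<Rightarrow> 'a"
  where
  "E_alpha0 0 = X"
| "E_alpha0 (Suc n) = inverse (q + inverse q) \<odot> ((E_delta1 \<otimes> E_alpha0 n) \<ominus> (E_alpha0 n \<otimes> E_delta1))"

primrec E_alpha1 :: "nat \<Rightarrow> 'a"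
  where
  "E_alpha1 0 = Y"
| "E_alpha1 (Suc n) = inverse (q + inverse q) \<odot> ((E_alpha1 n \<otimes> E_delta1) \<ominus> (E_delta1 \<otimes> E_alpha1 n))"

primrec E_delta :: "nat \<Rightarrow> 'a"
  where
  "E_delta 0 = (- inverse (q - inverse q)) \<odot> \<one>"
| "E_delta (Suc n) = (q powi (-2) \<odot> (E_alpha1 n \<otimes> X)) \<ominus> (X \<otimes> E_alpha1 n)"

end


section \<open>The generating functions\<close>

definition W_minus :: "'f::field \<Rightarrow> nat \<Rightarrow> 'f alt_elem"
  where "W_minus q = (\<lambda>n. W q (- int n))"

definition W_plus :: "'f::field \<Rightarrow> nat \<Rightarrow> 'f alt_elem"
  where "W_plus q = (\<lambda>n. W q (int n + 1))"

definition E_minus :: "'f::field \<Rightarrow> nat \<Rightarrow> 'f alt_elem"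
  where "E_minus q = E_alpha0 (Uq q) q (W q 0) (W q 1)"

definition E_plus :: "'f::field \<Rightarrow> nat \<Rightarrow> 'f alt_elem"
  where "E_plus q = E_alpha1 (Uq q) q (W q 0) (W q 1)"

definition E_series :: "'f::field \<Rightarrow> nat \<Rightarrow> 'f alt_elem"
  where "E_series q = E_delta (Uq q) q (W q 0) (W q 1)"

definition xi :: "'f::field \<Rightarrow> 'f"
  where "xi q = - (q\<^sup>2) * (q - inverse q) powi (-2)"

end

theory Submission
  imports Defs "HOL-Computational_Algebra.Formal_Power_Series"
begin

text \<open>The element \<open>Z\<^sup>\<or>\<^sub>1\<close> commutes with \<open>W\<^sub>0\<close> and \<open>W\<^sub>1\<close>, and \<open>E\<^sub>\<delta>\<close> is a linear combination of
  \<open>Z\<^sup>\<or>\<^sub>1\<close> and \<open>\<tilde>G\<^sub>1\<close>. So in the recursions for \<open>E\<^sup>-\<close> and \<open>E\<^sup>+\<close> the commutator with \<open>E\<^sub>\<delta>\<close> may be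
  replaced by a multiple of the commutator with \<open>\<tilde>G\<^sub>1\<close>, and the quotients on the right-hand sides
  satisfy the resulting recursions because of \<open>[\<tilde>G\<^sub>1, W\<^bsub>-k\<^esub>] = [\<tilde>G\<^bsub>k+1\<^esub>, W\<^sub>0]\<close> and its analogue for \<open>W\<^sub>1\<close>.
  With \<open>u = q\<^sup>2 v\<close>, the relations imply
  \<open>\<tilde>G(u) W\<^sup>-(v) = W\<^sup>-(u) \<tilde>G(v)\<close> and \<open>G(v) \<tilde>G(u) - G(u) \<tilde>G(v) = u [W\<^sup>-(v), W\<^sup>+(u)]\<close>.
  These turn the product of \<open>E\<close>, which is given by \<open>E\<^sup>+\<close> and \<open>W\<^sub>0\<close>, with \<open>\<tilde>G(u) \<tilde>G(v)\<close> into a multiple of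
  \<open>Z\<^sup>\<or>\<close>.\<close>

section \<open>Associative algebras over a field\<close>

locale assoc_algebra = vector_space scale
  for scale :: "'f::field \<Rightarrow> 'a::ring_1 \<Rightarrow> 'a" (infixr "*s" 75) +
  assumes scale_mult_left: "(c *s x) * y = c *s (x * y)"
    and scale_mult_right: "x * (c *s y) = c *s (x * y)"
begin

text \<open>Multiplying the first relation by \<open>q\<close> and combining it with the second
  eliminates \<open>b\<close> and \<open>c\<close>; what remains is \<open>q^2 - 1\<close> times
  \<open>a - d\<close>.\<close>

lemma qbracket_exchange:
  assumes "q \<noteq> 0" "q\<^sup>2 \<noteq> 1"
    and "q *s a - inverse q *s b = q *s c - inverse q *s d"
    and "q\<^sup>2 *s (d - c) = b - a"
  shows "a = d"
proof -
  have "q *s (q *s a - inverse q *s b) = q *s (q *s c - inverse q *s d)"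
    using assms(3) by simp
  then have "q\<^sup>2 *s a - b = q\<^sup>2 *s c - d"
    using assms(1) by (simp add: scale_right_diff_distrib power2_eq_square)
  then have "(q\<^sup>2 - 1) *s a = (q\<^sup>2 - 1) *s d"
    using assms(4) by (simp add: scale_right_diff_distrib scale_left_diff_distrib algebra_simps)
  then show ?thesis
    using assms(2) by simp
qed

text \<open>Left multiplications commute with right ones, and those on the same side commute because
  \<open>x\<close> and \<open>y\<close> do. So the q-brackets with \<open>x\<close> and with
  \<open>y\<close> commute as linear maps of \<open>w\<close>.\<close>

lemma qbracket_commute:
  assumes "x * y = y * x"
  shows "q *s (x * (q *s (y * w) - p *s (w * y))) - p *s ((q *s (y * w) - p *s (w * y)) * x)
       = q *s (y * (q *s (x * w) - p *s (w * x))) - p *s ((q *s (x * w) - p *s (w * x)) * y)"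
proof -
  have 1: "x * (y * w) = y * (x * w)" "w * (y * x) = w * (x * y)"
    using assms by (simp_all flip: mult.assoc)
  show ?thesis
    by (simp add: scale_right_diff_distrib scale_mult_left scale_mult_right algebra_simps 1)
qed

end

section \<open>Exchange relations at \<open>u = q\<^sup>2 v\<close>\<close>

text \<open>\<open>T\<close> is \<open>v\<close>; the letters \<open>g\<close>, \<open>h\<close>, \<open>m\<close>, \<open>p\<close> are the series \<open>G\<close>, \<open>\<tilde>G\<close>, \<open>W\<^sup>-\<close>, \<open>W\<^sup>+\<close>,
  and a second letter \<open>u\<close> or \<open>v\<close> is the argument.\<close>

locale alternating_values = assoc_algebra scale
  for scale :: "'f::field \<Rightarrow> 'a::ring_1 \<Rightarrow> 'a" (infixr "*s" 75) +
  fixes q :: 'f and T w0 w1 gu gv hu hv mu mv pu pv :: 'a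
  assumes q: "q \<noteq> 0" "q\<^sup>2 \<noteq> 1"
    and T_central: "\<And>x. x * T = T * x"
    and hm: "q *s (hu * w0) - inverse q *s (w0 * hu) = (q - inverse q) *s mu"
            "q *s (hv * w0) - inverse q *s (w0 * hv) = (q - inverse q) *s mv"
    and hp: "q *s (w1 * hu) - inverse q *s (hu * w1) = (q - inverse q) *s pu"
            "q *s (w1 * hv) - inverse q *s (hv * w1) = (q - inverse q) *s pv"
    and mw: "q\<^sup>2 *s T * (mu * w1 - w1 * mu) = (1 - inverse q ^ 2) *s (hu - gu)"
            "T * (mv * w1 - w1 * mv) = (1 - inverse q ^ 2) *s (hv - gv)"
    and wp: "q\<^sup>2 *s T * (w0 * pu - pu * w0) = (1 - inverse q ^ 2) *s (hu - gu)"
    and hh: "hu * hv = hv * hu"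
    and hg: "hu * gv - gv * hu = hv * gu - gu * hv"
    and mp: "mv * pu - pu * mv = mu * pv - pv * mu"
    and mh: "q\<^sup>2 *s (mu * hv - hv * mu) = mv * hu - hu * mv"
begin

lemma q_diff_nonzero: "q - inverse q \<noteq> 0"
  using q by (auto simp: field_simps power2_eq_square)

text \<open>By \<open>hm\<close>, \<open>mu\<close> and \<open>mv\<close> are multiples of the
  q-brackets of \<open>hu\<close> and \<open>hv\<close> with \<open>w0\<close>. Since
  \<open>hu\<close> and \<open>hv\<close> commute, the iterated brackets agree; this and
  \<open>mh\<close> are the two relations needed for \<open>qbracket_exchange\<close>.\<close>

lemma hu_mv: "hu * mv = mu * hv"
proof (rule qbracket_exchange[OF q])
  have "(q - inverse q) *s (q *s (hu * mv) - inverse q *s (mv * hu))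
      = q *s (hu * ((q - inverse q) *s mv)) - inverse q *s (((q - inverse q) *s mv) * hu)"
    by (simp add: scale_mult_left scale_mult_right scale_right_diff_distrib mult_ac)
  also have "\<dots> = q *s (hv * ((q - inverse q) *s mu)) - inverse q *s (((q - inverse q) *s mu) * hv)"
    unfolding hm[symmetric] by (rule qbracket_commute[OF hh])
  also have "\<dots> = (q - inverse q) *s (q *s (hv * mu) - inverse q *s (mu * hv))"
    by (simp add: scale_mult_left scale_mult_right scale_right_diff_distrib mult_ac)
  finally show "q *s (hu * mv) - inverse q *s (mv * hu) = q *s (hv * mu) - inverse q *s (mu * hv)"
    using q_diff_nonzero by simp
qed (rule mh)

text \<open>The commutator with \<open>m\<close> is a derivation; here it is applied to the
  q-bracket that gives \<open>p\<close>.\<close>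

lemma bracket_minus_plus:
  assumes p: "q *s (w1 * h) - inverse q *s (h * w1) = (q - inverse q) *s p"
  shows "(q - inverse q) *s (m * p - p * m)
    = q *s (w1 * (m * h - h * m)) - inverse q *s ((m * h - h * m) * w1)
      + (q *s ((m * w1 - w1 * m) * h) - inverse q *s (h * (m * w1 - w1 * m)))"
proof -
  have "(q - inverse q) *s (m * p - p * m) = m * ((q - inverse q) *s p) - ((q - inverse q) *s p) * m"
    by (simp add: scale_mult_left scale_mult_right scale_right_diff_distrib)
  then show ?thesis
    unfolding p[symmetric]
    by (simp add: scale_mult_left scale_mult_right scale_right_diff_distrib algebra_simps)
qed

text \<open>By \<open>mp\<close>, the commutator \<open>L\<close> has two expansions from
  \<open>bracket_minus_plus\<close>. Their terms with [m, h] differ by the factor q^2 and are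
  eliminated; multiplication by \<open>T\<close> then turns each remaining [m, w1] into a multiple
  of h - g.\<close>

lemma exchange_pm: "gv * hu - q\<^sup>2 *s T * (mv * pu) = gu * hv - q\<^sup>2 *s T * (pu * mv)"
proof -
  define L where "L = mv * pu - pu * mv"
  define P where "P = (\<lambda>x. q *s (w1 * x) - inverse q *s (x * w1))"
  define Ru where "Ru = q *s ((mu * w1 - w1 * mu) * hv) - inverse q *s (hv * (mu * w1 - w1 * mu))"
  define Rv where "Rv = q *s ((mv * w1 - w1 * mv) * hu) - inverse q *s (hu * (mv * w1 - w1 * mv))"
  have 1: "(q - inverse q) *s L = P (mv * hu - hu * mv) + Rv"
    unfolding L_def P_def Rv_def by (rule bracket_minus_plus[OF hp(1)])
  have 2: "(q - inverse q) *s L = P (mu * hv - hv * mu) + Ru"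
    unfolding L_def mp P_def Ru_def by (rule bracket_minus_plus[OF hp(2)])
  have 3: "P (mv * hu - hu * mv) = q\<^sup>2 *s P (mu * hv - hv * mu)"
    unfolding mh[symmetric] P_def
    by (simp add: scale_mult_left scale_mult_right scale_right_diff_distrib left_diff_distrib
        right_diff_distrib mult_ac)
  have 4: "((q\<^sup>2 - 1) * (q - inverse q)) *s L = q\<^sup>2 *s Ru - Rv"
  proof -
    have "q\<^sup>2 *s ((q - inverse q) *s L) - (q - inverse q) *s L = q\<^sup>2 *s Ru - Rv"
      by (subst 2, subst 1) (simp add: 3 scale_right_distrib)
    then show ?thesis
      by (simp only: scale_scale[symmetric] scale_left_diff_distrib[of "q\<^sup>2" 1] scale_one)
  qed
  have T_left: "x * (T * y) = T * (x * y)" for x y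
    by (metis T_central mult.assoc)
  have 5: "q\<^sup>2 *s (T * Ru) = (1 - inverse q ^ 2) *s (q *s ((hu - gu) * hv) - inverse q *s (hv * (hu - gu)))"
  proof -
    have *: "q\<^sup>2 *s (T * (q *s (x * hv) - inverse q *s (hv * x)))
        = q *s ((q\<^sup>2 *s T * x) * hv) - inverse q *s (hv * (q\<^sup>2 *s T * x))" for x
      by (simp add: T_left scale_mult_left scale_mult_right scale_right_diff_distrib
          right_diff_distrib mult_ac)
    show ?thesis
      unfolding Ru_def * mw
      by (simp add: scale_mult_left scale_mult_right scale_right_diff_distrib left_diff_distrib
          right_diff_distrib mult_ac)
  qed
  have 6: "T * Rv = (1 - inverse q ^ 2) *s (q *s ((hv - gv) * hu) - inverse q *s (hu * (hv - gv)))"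
  proof -
    have *: "T * (q *s (x * hu) - inverse q *s (hu * x))
        = q *s ((T * x) * hu) - inverse q *s (hu * (T * x))" for x
      by (simp add: T_left scale_mult_left scale_mult_right right_diff_distrib mult.assoc)
    show ?thesis
      unfolding Rv_def * mw
      by (simp add: scale_mult_left scale_mult_right scale_right_diff_distrib left_diff_distrib
          right_diff_distrib mult_ac)
  qed
  have "((q\<^sup>2 - 1) * (q - inverse q)) *s (T * L) = q\<^sup>2 *s (T * Ru) - T * Rv"
    using arg_cong[OF 4, of "\<lambda>x. T * x"] by (simp add: scale_mult_right right_diff_distrib)
  \<comment> \<open>The products of \<open>hu\<close> and \<open>hv\<close> cancel because they
    commute; after that, \<open>hg\<close> identifies the two remaining differences.\<close>
  also have "\<dots> = (1 - inverse q ^ 2) *s (q *s (gv * hu - gu * hv) - inverse q *s (hu * gv - hv * gu))"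
    unfolding 5 6 using hh
    by (simp add: scale_right_diff_distrib left_diff_distrib right_diff_distrib)
  also have "hu * gv - hv * gu = gv * hu - gu * hv"
    using hg by (simp add: algebra_simps)
  also have "q *s (gv * hu - gu * hv) - inverse q *s (gv * hu - gu * hv)
      = (q - inverse q) *s (gv * hu - gu * hv)"
    by (simp add: scale_left_diff_distrib)
  also have "(q\<^sup>2 - 1) * (q - inverse q) = (1 - inverse q ^ 2) * ((q - inverse q) * q\<^sup>2)"
    using q by (simp add: field_simps power2_eq_square)
  finally have "(1 - inverse q ^ 2) *s (q - inverse q) *s q\<^sup>2 *s (T * L)
      = (1 - inverse q ^ 2) *s (q - inverse q) *s (gv * hu - gu * hv)"
    by (simp only: scale_scale)
  moreover have "1 - inverse q ^ 2 \<noteq> 0"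
    using q by (auto simp: field_simps power2_eq_square)
  ultimately have "q\<^sup>2 *s (T * L) = gv * hu - gu * hv"
    using q_diff_nonzero by (simp only: scale_cancel_left simp_thms)
  then show ?thesis
    unfolding L_def by (simp add: scale_mult_left right_diff_distrib scale_right_diff_distrib algebra_simps)
qed

text \<open>Here \<open>pu * k\<close> is \<open>E\<^sup>+\<close>, and the factor in front of \<open>hu * hv\<close> is \<open>E\<close> without its constant term.\<close>

lemma imaginary_root_product:
  assumes k: "k * hu = 1"
  shows "q\<^sup>2 *s T * ((inverse q ^ 2 *s (pu * k * w0) - w0 * (pu * k)) * hu * hv)
    = (1 - inverse q ^ 2) *s (gv * hu - q\<^sup>2 *s T * (mv * pu) - hu * hv)"
proof -
  \<comment> \<open>This is \<open>hm\<close> solved for \<open>w0 * hu\<close>, so that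
    \<open>hu\<close> meets \<open>k\<close> and cancels.\<close>
  have w0_hu: "w0 * hu = q\<^sup>2 *s (hu * w0) - (q\<^sup>2 - 1) *s mu"
  proof -
    have "q *s (q *s (hu * w0) - inverse q *s (w0 * hu)) = q *s (q - inverse q) *s mu"
      using hm(1) by simp
    then show ?thesis
      using q by (simp add: scale_right_diff_distrib algebra_simps power2_eq_square)
  qed
  have k1: "k * (hu * x) = x" for x
    using k by (simp flip: mult.assoc)
  \<comment> \<open>The factor \<open>hv\<close> on the right lets \<open>hu_mv\<close> remove the
    inverse \<open>k\<close> from the term with \<open>mu\<close>.\<close>
  have k2: "k * mu * hv = mv"
    by (simp add: mult.assoc hu_mv[symmetric] k1)
  have "(inverse q ^ 2 *s (pu * k * w0) - w0 * (pu * k)) * hu * hv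
      = inverse q ^ 2 *s (pu * (k * (w0 * hu)) * hv) - w0 * pu * (k * hu) * hv"
    by (simp add: scale_mult_left left_diff_distrib mult.assoc)
  also have "\<dots> = pu * w0 * hv - (1 - inverse q ^ 2) *s (pu * mv) - w0 * pu * hv"
  proof -
    have "k * (w0 * hu) = q\<^sup>2 *s w0 - (q\<^sup>2 - 1) *s (k * mu)"
      by (simp add: w0_hu right_diff_distrib scale_mult_right k1)
    then have "pu * (k * (w0 * hu)) * hv = q\<^sup>2 *s (pu * w0 * hv) - (q\<^sup>2 - 1) *s (pu * (k * mu * hv))"
      by (simp add: right_diff_distrib left_diff_distrib scale_mult_right scale_mult_left mult.assoc)
    moreover have "inverse q ^ 2 * q\<^sup>2 = 1"
      using q by (simp flip: power_mult_distrib)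
    ultimately show ?thesis
      by (simp add: k k2 scale_right_diff_distrib right_diff_distrib)
  qed
  also have "\<dots> = - ((w0 * pu - pu * w0) * hv) - (1 - inverse q ^ 2) *s (pu * mv)"
    by (simp add: algebra_simps)
  finally have "q\<^sup>2 *s T * ((inverse q ^ 2 *s (pu * k * w0) - w0 * (pu * k)) * hu * hv)
      = - ((q\<^sup>2 *s T * (w0 * pu - pu * w0)) * hv) - (1 - inverse q ^ 2) *s (q\<^sup>2 *s T * (pu * mv))"
    by (simp add: left_diff_distrib right_diff_distrib scale_mult_right scale_mult_left
        scale_right_diff_distrib mult.assoc)
  also have "\<dots> = (1 - inverse q ^ 2) *s (gu * hv - q\<^sup>2 *s T * (pu * mv) - hu * hv)"
    unfolding wp by (simp add: scale_mult_left scale_right_diff_distrib left_diff_distrib)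
  \<comment> \<open>\<open>exchange_pm\<close> brings the products into the order in which they
    occur in \<open>Zv\<close>.\<close>
  finally show ?thesis
    by (simp only: exchange_pm)
qed

end

section \<open>Generating functions\<close>

lemma (in monoid_mult) right_inverse_commute:
  assumes "h * k = 1" "k * h = 1" "x * h = h * x"
  shows "x * k = k * x"
  by (metis assms mult.assoc mult_1_left mult_1_right)

lemma fps_invertible:
  fixes f :: "'a::ring_1 fps"
  assumes "fps_nth f 0 = 1"
  shows "\<exists>k. f * k = 1 \<and> k * f = 1"
  using fps_right_inverse[of f 1] fps_left_inverse'[of 1 f 1] assms by auto

context assoc_algebra
begin

definition fps_scale :: "'f \<Rightarrow> 'a fps \<Rightarrow> 'a fps"
  where "fps_scale c f = Abs_fps (\<lambda>n. c *s fps_nth f n)"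

text \<open>The scaled argument is built in: this is a(c t), so that one family gives the series at
  both arguments u and v.\<close>

definition series :: "'f \<Rightarrow> (nat \<Rightarrow> 'a) \<Rightarrow> 'a fps"
  where "series c a = Abs_fps (\<lambda>n. c ^ n *s a n)"

lemma fps_scale_nth [simp]: "fps_nth (fps_scale c f) n = c *s fps_nth f n"
  by (simp add: fps_scale_def)

lemma series_nth [simp]: "fps_nth (series c a) n = c ^ n *s a n"
  by (simp add: series_def)

text \<open>Through this instance, the results on elements, including
  \<open>alternating_values\<close>, apply to generating functions.\<close>

lemma assoc_algebra_fps: "assoc_algebra fps_scale"
  by standard
    (simp_all add: fps_eq_iff fps_mult_nth scale_right_distrib scale_left_distrib
      scale_mult_left scale_mult_right scale_sum_right)

lemma series_bracket_nth:
  "fps_nth (series c a * series d b - series d b * series c a) n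
    = (\<Sum>i=0..n. (c ^ i * d ^ (n - i)) *s (a i * b (n - i) - b (n - i) * a i))"
proof -
  have "fps_nth (series d b * series c a) n
      = (\<Sum>i=0..n. d ^ (n - i) *s b (n - i) * c ^ i *s a i)"
    unfolding fps_mult_nth by (subst sum.atLeastAtMost_rev) simp
  then show ?thesis
    by (simp add: fps_mult_nth scale_mult_left scale_mult_right scale_right_diff_distrib
        sum_subtractf mult_ac)
qed

lemma series_commute:
  assumes "\<And>i j. a i * b j = b j * a i"
  shows "series c a * series d b = series d b * series c a"
proof -
  have "series c a * series d b - series d b * series c a = 0"
    by (rule fps_ext) (simp add: series_bracket_nth assms del: fps_sub_nth)
  then show ?thesis
    by simp
qed

text \<open>Reversing the sum exchanges the two arguments, and the assumption makes the commutators
  symmetric in the indices.\<close>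

lemma series_bracket_swap:
  assumes "\<And>i j. a i * b j - b j * a i = a j * b i - b i * a j"
  shows "series c a * series d b - series d b * series c a
    = series d a * series c b - series c b * series d a"
proof (rule fps_ext)
  fix n
  have "fps_nth (series d a * series c b - series c b * series d a) n
      = (\<Sum>i=0..n. (d ^ (n - i) * c ^ i) *s (a (n - i) * b i - b i * a (n - i)))"
    unfolding series_bracket_nth by (subst sum.atLeastAtMost_rev) simp
  then show "fps_nth (series c a * series d b - series d b * series c a) n
      = fps_nth (series d a * series c b - series c b * series d a) n"
    by (simp only: series_bracket_nth assms mult.commute)
qed

text \<open>In the symmetry the index of \<open>b\<close> is shifted by one. As
  \<open>b 0 = 1\<close> drops out of the commutator, the weights are c^i d^(j+1); one more factor c
  makes the exponents match, and the sum can be reversed.\<close>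

lemma series_bracket_shift:
  assumes "b 0 = 1" and "\<And>i j. a i * b (Suc j) - b (Suc j) * a i = a j * b (Suc i) - b (Suc i) * a j"
  shows "fps_scale c (series c a * series d b - series d b * series c a)
    = fps_scale d (series d a * series c b - series c b * series d a)"
proof (rule fps_ext)
  fix n
  show "fps_nth (fps_scale c (series c a * series d b - series d b * series c a)) n
      = fps_nth (fps_scale d (series d a * series c b - series c b * series d a)) n"
  proof (cases n)
    case 0
    then show ?thesis
      by (simp add: assms(1))
  next
    case (Suc m)
    have nth: "x *s fps_nth (series x a * series y b - series y b * series x a) n
        = (\<Sum>i=0..m. (x ^ Suc i * y ^ Suc (m - i)) *s (a i * b (Suc (m - i)) - b (Suc (m - i)) * a i))"
      for x y
      unfolding series_bracket_nth Suc
      by (simp add: assms(1) scale_sum_right Suc_diff_le mult_ac)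
    have "c *s fps_nth (series c a * series d b - series d b * series c a) n
        = (\<Sum>i=0..m. (c ^ Suc (m - i) * d ^ Suc i) *s (a (m - i) * b (Suc i) - b (Suc i) * a (m - i)))"
      unfolding nth by (subst sum.atLeastAtMost_rev) simp
    also have "\<dots> = d *s fps_nth (series d a * series c b - series c b * series d a) n"
      unfolding nth by (intro sum.cong refl) (simp only: assms(2) mult.commute)
    finally show ?thesis
      by (simp only: fps_scale_nth)
  qed
qed

text \<open>The last assumption says that a(c t) - a(0) h(c t) = e t [x, a(c t)]. Since
  \<open>x\<close> commutes with h(c t), it commutes with \<open>k\<close>, and multiplying by
  \<open>k\<close> on the right replaces a(c t) by the quotient and h(c t) by 1.\<close>

lemma quotient_series_recursion:
  assumes k: "series c h * k = 1" "k * series c h = 1"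
    and h: "h 0 = 1" "\<And>n. x * h n = h n * x"
    and a: "\<And>n. c *s (a (Suc n) - a 0 * h (Suc n)) = e *s (x * a n - a n * x)"
  shows "fps_nth (series c a * k) 0 = a 0"
    and "fps_nth (series c a * k) (Suc n)
      = e *s (x * fps_nth (series c a * k) n - fps_nth (series c a * k) n * x)"
proof -
  interpret S: assoc_algebra fps_scale
    by (rule assoc_algebra_fps)
  let ?x = "fps_const x" and ?a = "series c a" and ?h = "series c h"
  have "?x * ?h = ?h * ?x"
    by (simp add: fps_eq_iff h(2) scale_mult_left scale_mult_right)
  then have xk: "?x * k = k * ?x"
    using right_inverse_commute k by blast
  have "?a - fps_const (a 0) * ?h = fps_X * fps_scale e (?x * ?a - ?a * ?x)"
  proof (rule fps_ext)
    fix n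
    show "fps_nth (?a - fps_const (a 0) * ?h) n = fps_nth (fps_X * fps_scale e (?x * ?a - ?a * ?x)) n"
    proof (cases n)
      case (Suc m)
      have "fps_nth (?a - fps_const (a 0) * ?h) n = c ^ m *s c *s (a (Suc m) - a 0 * h (Suc m))"
        by (simp add: Suc scale_mult_left scale_mult_right scale_right_diff_distrib mult_ac)
      then show ?thesis
        unfolding a
        by (simp add: Suc scale_mult_left scale_mult_right scale_right_diff_distrib mult_ac)
    qed (simp add: h)
  qed
  then have "(?a - fps_const (a 0) * ?h) * k = fps_X * fps_scale e (?x * ?a - ?a * ?x) * k"
    by simp
  then have "?a * k - fps_const (a 0) = fps_X * fps_scale e (?x * (?a * k) - (?a * k) * ?x)"
    by (simp add: left_diff_distrib S.scale_mult_left mult.assoc k xk)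
  then have eq: "?a * k = fps_const (a 0) + fps_X * fps_scale e (?x * (?a * k) - (?a * k) * ?x)"
    by (simp add: algebra_simps)
  show "fps_nth (?a * k) 0 = a 0"
    by (subst eq) simp
  show "fps_nth (?a * k) (Suc n) = e *s (x * fps_nth (?a * k) n - fps_nth (?a * k) n * x)"
    by (subst eq) simp
qed

end

section \<open>The alternating relations\<close>

text \<open>The families \<open>m\<close>, \<open>p\<close>, \<open>g\<close>, \<open>h\<close> stand for \<open>W\<^bsub>-k\<^esub>\<close>, \<open>W\<^bsub>k+1\<^esub>\<close>, \<open>G\<^sub>k\<close>, \<open>\<tilde>G\<^sub>k\<close>.\<close>

locale alternating_family = assoc_algebra scale
  for scale :: "'f::field \<Rightarrow> 'a::ring_1 \<Rightarrow> 'a" (infixr "*s" 75) +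
  fixes q :: 'f and m p g h :: "nat \<Rightarrow> 'a"
  assumes q: "q \<noteq> 0" "q ^ 2 \<noteq> 1" "q ^ 2 \<noteq> - 1"
    and g0: "g 0 = 1" and h0: "h 0 = 1"
    and m0_p: "m 0 * p k - p k * m 0 = (1 - inverse q ^ 2) *s (h (Suc k) - g (Suc k))"
    and m_p0: "m k * p 0 - p 0 * m k = (1 - inverse q ^ 2) *s (h (Suc k) - g (Suc k))"
    and m0_g: "q *s (m 0 * g (Suc k)) - inverse q *s (g (Suc k) * m 0) = (q - inverse q) *s m (Suc k)"
    and h_m0: "q *s (h (Suc k) * m 0) - inverse q *s (m 0 * h (Suc k)) = (q - inverse q) *s m (Suc k)"
    and g_p0: "q *s (g (Suc k) * p 0) - inverse q *s (p 0 * g (Suc k)) = (q - inverse q) *s p (Suc k)"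
    and p0_h: "q *s (p 0 * h (Suc k)) - inverse q *s (h (Suc k) * p 0) = (q - inverse q) *s p (Suc k)"
    and m_p: "(m k * p l - p l * m k) + (p k * m l - m l * p k) = 0"
    and m_h: "(m k * h (Suc l) - h (Suc l) * m k) + (h (Suc k) * m l - m l * h (Suc k)) = 0"
    and p_h: "(p k * h (Suc l) - h (Suc l) * p k) + (h (Suc k) * p l - p l * h (Suc k)) = 0"
    and h_h: "h (Suc k) * h (Suc l) - h (Suc l) * h (Suc k) = 0"
    and h_g: "(h (Suc k) * g (Suc l) - g (Suc l) * h (Suc k))
      + (g (Suc k) * h (Suc l) - h (Suc l) * g (Suc k)) = 0"
begin

lemma q_diff_nonzero: "q - inverse q \<noteq> 0"
  using q by (auto simp: field_simps power2_eq_square)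

lemma q_sum_nonzero: "q + inverse q \<noteq> 0"
  using q by (auto simp: field_simps power2_eq_square eq_neg_iff_add_eq_0)

lemma h_commute: "h i * h j = h j * h i"
  using h_h by (cases i; cases j) (auto simp: h0)

text \<open>\<open>beta\<close> and \<open>alpha\<close> are \<open>q\<^sup>-\<^sup>1 \<xi>\<^sup>-\<^sup>1\<close> and \<open>q \<xi>\<^sup>-\<^sup>1\<close>.\<close>

definition beta :: 'f
  where "beta = - (inverse q ^ 3 * (q - inverse q) ^ 2)"

definition alpha :: 'f
  where "alpha = - (inverse q * (q - inverse q) ^ 2)"

lemma alpha_eq: "alpha = q ^ 2 * beta"
  using q by (simp add: alpha_def beta_def field_simps power3_eq_cube power2_eq_square)

lemma nonzero: "alpha \<noteq> 0" "beta \<noteq> 0"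
  using q q_diff_nonzero by (auto simp: alpha_def beta_def)

text \<open>The arguments are u = alpha t and v = beta t, whose ratio is q^2 by
  \<open>alpha_eq\<close>.\<close>

lemma alternating_values_series:
  "alternating_values fps_scale q (fps_scale beta fps_X) (fps_const (m 0)) (fps_const (p 0))
    (series alpha g) (series beta g) (series alpha h) (series beta h)
    (series alpha m) (series beta m) (series alpha p) (series beta p)"
proof -
  interpret S: assoc_algebra fps_scale
    by (rule assoc_algebra_fps)
  \<comment> \<open>In degree 0 there is no relation to quote; there \<open>h 0 = 1\<close> gives
    the equation.\<close>
  have hm: "fps_scale q (series c h * fps_const (m 0)) - fps_scale (inverse q) (fps_const (m 0) * series c h)
      = fps_scale (q - inverse q) (series c m)" for c
  proof (rule fps_ext)
    fix n
    show "fps_nth (fps_scale q (series c h * fps_const (m 0))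
        - fps_scale (inverse q) (fps_const (m 0) * series c h)) n
      = fps_nth (fps_scale (q - inverse q) (series c m)) n"
    proof (cases n)
      case 0
      then show ?thesis
        by (simp add: h0 scale_left_diff_distrib)
    next
      case (Suc k)
      then show ?thesis
        using arg_cong[OF h_m0[of k], of "\<lambda>x. c ^ n *s x"]
        by (simp add: scale_mult_left scale_mult_right scale_right_diff_distrib mult_ac)
    qed
  qed
  have hp: "fps_scale q (fps_const (p 0) * series c h) - fps_scale (inverse q) (series c h * fps_const (p 0))
      = fps_scale (q - inverse q) (series c p)" for c
  proof (rule fps_ext)
    fix n
    show "fps_nth (fps_scale q (fps_const (p 0) * series c h)
        - fps_scale (inverse q) (series c h * fps_const (p 0))) n
      = fps_nth (fps_scale (q - inverse q) (series c p)) n"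
    proof (cases n)
      case 0
      then show ?thesis
        by (simp add: h0 scale_left_diff_distrib)
    next
      case (Suc k)
      then show ?thesis
        using arg_cong[OF p0_h[of k], of "\<lambda>x. c ^ n *s x"]
        by (simp add: scale_mult_left scale_mult_right scale_right_diff_distrib mult_ac)
    qed
  qed
  \<comment> \<open>The factor c t shifts degrees: \<open>m_p0\<close> at \<open>k\<close> is the
    equation in degree k + 1, and in degree 0 the right side vanishes because
    \<open>h 0 = g 0\<close>.\<close>
  have mw: "fps_scale c fps_X * (series c m * fps_const (p 0) - fps_const (p 0) * series c m)
      = fps_scale (1 - inverse q ^ 2) (series c h - series c g)" for c
  proof (rule fps_ext)
    fix n
    show "fps_nth (fps_scale c fps_X * (series c m * fps_const (p 0) - fps_const (p 0) * series c m)) n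
      = fps_nth (fps_scale (1 - inverse q ^ 2) (series c h - series c g)) n"
    proof (cases n)
      case 0
      then show ?thesis
        by (simp add: g0 h0)
    next
      case (Suc k)
      then show ?thesis
        using arg_cong[OF m_p0[of k], of "\<lambda>x. c ^ n *s x"]
        by (simp add: S.scale_mult_left scale_mult_left scale_mult_right scale_right_diff_distrib mult_ac)
    qed
  qed
  have wp: "fps_scale c fps_X * (fps_const (m 0) * series c p - series c p * fps_const (m 0))
      = fps_scale (1 - inverse q ^ 2) (series c h - series c g)" for c
  proof (rule fps_ext)
    fix n
    show "fps_nth (fps_scale c fps_X * (fps_const (m 0) * series c p - series c p * fps_const (m 0))) n
      = fps_nth (fps_scale (1 - inverse q ^ 2) (series c h - series c g)) n"
    proof (cases n)
      case 0
      then show ?thesis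
        by (simp add: g0 h0)
    next
      case (Suc k)
      then show ?thesis
        using arg_cong[OF m0_p[of k], of "\<lambda>x. c ^ n *s x"]
        by (simp add: S.scale_mult_left scale_mult_left scale_mult_right scale_right_diff_distrib mult_ac)
    qed
  qed
  have u: "fps_scale (q\<^sup>2) (fps_scale beta fps_X) = fps_scale alpha fps_X"
    by (simp add: alpha_eq)
  have hg: "h i * g j - g j * h i = h j * g i - g i * h j" for i j
    using h_g[of "i - 1" "j - 1"] by (cases i; cases j) (simp_all add: g0 h0 algebra_simps)
  have mp: "m i * p j - p j * m i = m j * p i - p i * m j" for i j
    using m_p[of i j] by (simp add: algebra_simps)
  have mh: "m i * h (Suc j) - h (Suc j) * m i = m j * h (Suc i) - h (Suc i) * m j" for i j
    using m_h[of i j] by (simp add: algebra_simps)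
  \<comment> \<open>The factors alpha and beta produced by the shift have ratio q^2, so a common
    beta can be cancelled.\<close>
  have "fps_scale beta (fps_scale (q\<^sup>2) (series alpha m * series beta h - series beta h * series alpha m))
      = fps_scale beta (series beta m * series alpha h - series alpha h * series beta m)"
    using series_bracket_shift[of h m, OF h0 mh, of alpha beta] by (simp add: alpha_eq mult.commute)
  then have mh': "fps_scale (q\<^sup>2) (series alpha m * series beta h - series beta h * series alpha m)
      = series beta m * series alpha h - series alpha h * series beta m"
    by (simp only: S.scale_cancel_left nonzero simp_thms)
  have T: "x * fps_scale beta fps_X = fps_scale beta fps_X * x" for x
    by (simp add: S.scale_mult_left S.scale_mult_right fps_mult_fps_X_commute)
  note hh' = series_commute[of h h, OF h_commute, of alpha beta]
  note hg' = series_bracket_swap[of h g, OF hg, of alpha beta]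
  note mp' = series_bracket_swap[of m p, OF mp, of beta alpha]
  show ?thesis
    by (intro alternating_values.intro alternating_values_axioms.intro assoc_algebra_fps)
      (fact q T hm hp mw[of alpha, folded u] mw wp[of alpha, folded u] hh' hg' mp' mh')+
qed

end

section \<open>Damiani's recursions for the quotients\<close>

context alternating_family
begin

text \<open>Up to the factor \<open>q\<close>, the element \<open>central1\<close> is \<open>Z\<^sup>\<or>\<^sub>1\<close>.\<close>

definition central1 :: 'a
  where "central1 = h 1 + inverse q ^ 2 *s g 1 - m 0 * p 0"

text \<open>Damiani's \<open>E_delta1\<close> for \<open>X = m 0\<close> and
  \<open>Y = p 0\<close>.\<close>

definition delta1 :: 'a
  where "delta1 = inverse q ^ 2 *s (p 0 * m 0) - m 0 * p 0"

text \<open>Reordering \<open>p 0 * m 0\<close> inside \<open>m 0 * p 0 * m 0\<close> costs a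
  multiple of \<open>m 0 * (h 1 - g 1)\<close>. What is left cancels because \<open>m0_g\<close> and
  \<open>h_m0\<close> give the same multiple of \<open>m 1\<close>.\<close>

lemma central1_m0: "central1 * m 0 = m 0 * central1"
proof -
  let ?r = "inverse q"
  have pm: "p 0 * m 0 = m 0 * p 0 - (1 - ?r ^ 2) *s (h 1 - g 1)"
    using m_p0[of 0] by (simp add: algebra_simps)
  have "?r *s (q *s (m 0 * g 1) - ?r *s (g 1 * m 0)) = ?r *s (q *s (h 1 * m 0) - ?r *s (m 0 * h 1))"
    using m0_g[of 0] h_m0[of 0] by simp
  then have gh: "m 0 * g 1 - ?r ^ 2 *s (g 1 * m 0) = h 1 * m 0 - ?r ^ 2 *s (m 0 * h 1)"
    using q by (simp add: scale_right_diff_distrib power2_eq_square)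
  have "m 0 * p 0 * m 0 = m 0 * (m 0 * p 0) - (1 - ?r ^ 2) *s (m 0 * (h 1 - g 1))"
    by (simp add: pm right_diff_distrib scale_mult_right mult.assoc)
  then show ?thesis
    unfolding central1_def using gh
    by (simp add: scale_mult_left scale_mult_right scale_right_diff_distrib algebra_simps)
qed

lemma central1_p0: "central1 * p 0 = p 0 * central1"
proof -
  let ?r = "inverse q"
  have pm: "p 0 * m 0 = m 0 * p 0 - (1 - ?r ^ 2) *s (h 1 - g 1)"
    using m_p0[of 0] by (simp add: algebra_simps)
  have "?r *s (q *s (g 1 * p 0) - ?r *s (p 0 * g 1)) = ?r *s (q *s (p 0 * h 1) - ?r *s (h 1 * p 0))"
    using g_p0[of 0] p0_h[of 0] by simp
  then have gh: "g 1 * p 0 - ?r ^ 2 *s (p 0 * g 1) = p 0 * h 1 - ?r ^ 2 *s (h 1 * p 0)"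
    using q by (simp add: scale_right_diff_distrib power2_eq_square)
  have "p 0 * (m 0 * p 0) = m 0 * p 0 * p 0 - (1 - ?r ^ 2) *s ((h 1 - g 1) * p 0)"
    by (simp add: pm left_diff_distrib scale_mult_left flip: mult.assoc)
  then show ?thesis
    unfolding central1_def using gh
    by (simp add: scale_mult_left scale_mult_right scale_right_diff_distrib algebra_simps)
qed

lemma delta1_eq: "delta1 = (1 - inverse q ^ 2) *s (central1 - (1 + inverse q ^ 2) *s h 1)"
proof -
  have pm: "p 0 * m 0 = m 0 * p 0 - (1 - inverse q ^ 2) *s (h 1 - g 1)"
    using m_p0[of 0] by (simp add: algebra_simps)
  show ?thesis
    unfolding delta1_def central1_def pm
    by (simp add: scale_right_diff_distrib scale_right_distrib algebra_simps)
qed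

lemma central1_delta1: "central1 * delta1 = delta1 * central1"
proof -
  have "central1 * (p 0 * m 0) = p 0 * m 0 * central1" "central1 * (m 0 * p 0) = m 0 * p 0 * central1"
    by (metis central1_m0 central1_p0 mult.assoc)+
  then show ?thesis
    by (simp add: delta1_def left_diff_distrib right_diff_distrib scale_mult_left scale_mult_right)
qed

text \<open>Modulo the central element, \<open>E\<^sub>\<delta>\<close> is a multiple of \<open>\<tilde>G\<^sub>1\<close>, so both have proportional
  commutators.\<close>

lemma bracket_delta1:
  assumes "f 0 * central1 = central1 * f 0"
    and "\<And>n. f (Suc n) = e *s (h 1 * f n - f n * h 1)"
  shows "delta1 * f n - f n * delta1 = (inverse q ^ 4 - 1) *s (h 1 * f n - f n * h 1)"
proof -
  have *: "delta1 * x - x * delta1 = (inverse q ^ 4 - 1) *s (h 1 * x - x * h 1)"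
    if "x * central1 = central1 * x" for x
  proof -
    have "a *s (central1 - b *s h 1) * x - x * (a *s (central1 - b *s h 1))
        = - (a * b) *s (h 1 * x - x * h 1)" for a b
      using that
      by (simp add: scale_mult_left scale_mult_right scale_right_diff_distrib right_diff_distrib
          left_diff_distrib)
    then have "delta1 * x - x * delta1
        = - ((1 - inverse q ^ 2) * (1 + inverse q ^ 2)) *s (h 1 * x - x * h 1)"
      unfolding delta1_eq .
    also have "- ((1 - inverse q ^ 2) * (1 + inverse q ^ 2)) = inverse q ^ 4 - 1"
      by (simp add: algebra_simps flip: power_add)
    finally show ?thesis .
  qed
  have ne: "inverse q ^ 4 - 1 \<noteq> 0"
  proof
    assume "inverse q ^ 4 - 1 = 0"
    then have "(q\<^sup>2 - 1) * (q\<^sup>2 + 1) = 0"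
      using q by (simp add: field_simps flip: power_add)
    then show False
      using q by (auto simp: eq_neg_iff_add_eq_0)
  qed
  \<comment> \<open>In the induction step, \<open>*\<close> replaces the bracket with
    \<open>h 1\<close> by one with \<open>delta1\<close>, which commutes with
    \<open>central1\<close>; the resulting factor is nonzero and cancels.\<close>
  have "f n * central1 = central1 * f n"
  proof (induction n)
    case (Suc n)
    have "(inverse q ^ 4 - 1) *s f (Suc n) = e *s (delta1 * f n - f n * delta1)"
      by (simp add: *[OF Suc] assms(2) mult.commute)
    moreover have "(delta1 * f n) * central1 = central1 * (delta1 * f n)"
      "(f n * delta1) * central1 = central1 * (f n * delta1)"
      by (metis Suc central1_delta1 mult.assoc)+
    ultimately have "((inverse q ^ 4 - 1) *s f (Suc n)) * central1
        = central1 * ((inverse q ^ 4 - 1) *s f (Suc n))"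
      by (simp add: scale_mult_left scale_mult_right left_diff_distrib right_diff_distrib)
    then show ?case
      using ne by (simp only: scale_mult_left scale_mult_right scale_cancel_left simp_thms)
  qed (rule assms)
  then show ?thesis
    by (rule *)
qed

text \<open>Damiani's denominator q + 1/q, combined with the factor of
  \<open>bracket_delta1\<close>, yields up to sign the coefficient \<open>?e\<close> of the quotient
  recursions below.\<close>

lemma coefficient_eq: "inverse (q + inverse q) * (inverse q ^ 4 - 1) = - (inverse q ^ 2 * (q - inverse q))"
proof -
  have "inverse q ^ 4 - 1 = (q + inverse q) * - (inverse q ^ 2 * (q - inverse q))"
    using q by (simp add: field_simps power2_eq_square power4_eq_xxxx)
  then show ?thesis
    using q_sum_nonzero by simp
qed

lemma minus_quotient:
  assumes k: "series beta h * k = 1" "k * series beta h = 1"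
  defines "f \<equiv> fps_nth (series beta m * k)"
  shows "f 0 = m 0" "f (Suc n) = inverse (q + inverse q) *s (delta1 * f n - f n * delta1)"
proof -
  let ?e = "- (inverse q ^ 2 * (q - inverse q))"
  \<comment> \<open>\<open>h_m0\<close> makes the left side a multiple of [h (n+1), m 0], and
    \<open>m_h\<close> turns this into [h 1, m n]. The value of \<open>beta\<close> is the one that
    makes the coefficient equal to \<open>?e\<close>.\<close>
  have rec: "beta *s (m (Suc n) - m 0 * h (Suc n)) = ?e *s (h 1 * m n - m n * h 1)" for n
  proof -
    have "h 1 * m n - m n * h 1 = h (Suc n) * m 0 - m 0 * h (Suc n)"
      using m_h[of n 0] by (simp add: algebra_simps)
    moreover have "(q - inverse q) *s (m (Suc n) - m 0 * h (Suc n))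
        = q *s (h (Suc n) * m 0 - m 0 * h (Suc n))"
      unfolding scale_right_diff_distrib[of "q - inverse q"] h_m0[of n, symmetric]
      by (simp add: scale_left_diff_distrib scale_right_diff_distrib)
    moreover have "beta = ?e * inverse q * (q - inverse q)" "?e * inverse q * q = ?e"
      using q by (simp_all add: beta_def power2_eq_square power3_eq_cube)
    ultimately show ?thesis
      by (metis scale_scale)
  qed
  have h1: "h 1 * h n = h n * h 1" for n
    by (rule h_commute)
  note F = quotient_series_recursion[OF k h0 h1 rec, folded f_def]
  show "f 0 = m 0"
    by (rule F)
  have "f 0 * central1 = central1 * f 0"
    by (simp add: F central1_m0)
  from bracket_delta1[OF this F(2)] show "f (Suc n) = inverse (q + inverse q) *s (delta1 * f n - f n * delta1)"
    by (simp add: F(2) coefficient_eq)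
qed

lemma plus_quotient:
  assumes k: "series alpha h * k = 1" "k * series alpha h = 1"
  defines "f \<equiv> fps_nth (series alpha p * k)"
  shows "f 0 = p 0" "f (Suc n) = inverse (q + inverse q) *s (f n * delta1 - delta1 * f n)"
proof -
  let ?e = "inverse q ^ 2 * (q - inverse q)"
  \<comment> \<open>Here the q-bracket contributes -1/q where the case of \<open>m\<close> has q.
    This accounts for the ratio of \<open>alpha\<close> to \<open>beta\<close> and for the opposite
    sign of \<open>?e\<close>, which matches the reversed commutator.\<close>
  have rec: "alpha *s (p (Suc n) - p 0 * h (Suc n)) = ?e *s (h 1 * p n - p n * h 1)" for n
  proof -
    have "h 1 * p n - p n * h 1 = h (Suc n) * p 0 - p 0 * h (Suc n)"
      using p_h[of n 0] by (simp add: algebra_simps)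
    moreover have "(q - inverse q) *s (p (Suc n) - p 0 * h (Suc n))
        = (- inverse q) *s (h (Suc n) * p 0 - p 0 * h (Suc n))"
      unfolding scale_right_diff_distrib[of "q - inverse q"] p0_h[of n, symmetric]
      by (simp add: scale_left_diff_distrib scale_right_diff_distrib)
    moreover have "alpha = - ?e * q * (q - inverse q)" "- ?e * q * (- inverse q) = ?e"
      using q by (simp_all add: alpha_def power2_eq_square power3_eq_cube)
    ultimately show ?thesis
      by (metis scale_scale)
  qed
  have h1: "h 1 * h n = h n * h 1" for n
    by (rule h_commute)
  note F = quotient_series_recursion[OF k h0 h1 rec, folded f_def]
  show "f 0 = p 0"
    by (rule F)
  have "f 0 * central1 = central1 * f 0"
    by (simp add: F central1_p0)
  from bracket_delta1[OF this F(2), of n]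
  have "inverse (q + inverse q) *s (delta1 * f n - f n * delta1) = - f (Suc n)"
    by (simp add: F(2) coefficient_eq)
  then show "f (Suc n) = inverse (q + inverse q) *s (f n * delta1 - delta1 * f n)"
    by (metis minus_diff_eq minus_minus scale_minus_right)
qed

text \<open>The series \<open>Z\<^sup>\<or>(\<xi>\<^sup>-\<^sup>1 t)\<close>.\<close>

definition central :: "'a fps"
  where "central = series beta g * series alpha h
    - fps_scale alpha fps_X * (series beta m * series alpha p)"

text \<open>The claimed coefficients are those of \<open>?c + t r\<close>. By
  \<open>imaginary_root_product\<close>, multiplying this by both \<open>h\<close> series gives
  \<open>?c\<close> times \<open>central\<close>; the inverses \<open>kb\<close> and
  \<open>ka\<close> then undo the multiplication.\<close>

lemma imaginary_quotient:
  assumes kb: "series beta h * kb = 1" "kb * series beta h = 1"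
    and ka: "series alpha h * ka = 1" "ka * series alpha h = 1"
  defines "f \<equiv> fps_nth (fps_scale (- inverse (q - inverse q)) (central * kb * ka))"
    and "e \<equiv> fps_nth (series alpha p * ka)"
  shows "f 0 = (- inverse (q - inverse q)) *s 1"
    "f (Suc n) = inverse q ^ 2 *s (e n * m 0) - m 0 * e n"
proof -
  interpret S: assoc_algebra fps_scale
    by (rule assoc_algebra_fps)
  interpret V: alternating_values fps_scale q "fps_scale beta fps_X" "fps_const (m 0)" "fps_const (p 0)"
    "series alpha g" "series beta g" "series alpha h" "series beta h"
    "series alpha m" "series beta m" "series alpha p" "series beta p"
    by (rule alternating_values_series)
  let ?c = "- inverse (q - inverse q)"
  define r where "r = fps_scale (inverse q ^ 2) (series alpha p * ka * fps_const (m 0))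
    - fps_const (m 0) * (series alpha p * ka)"
  have u: "fps_scale (q\<^sup>2) (fps_scale beta fps_X) = fps_scale alpha fps_X"
    by (simp add: alpha_eq)
  have "fps_scale alpha (fps_X * (r * series alpha h * series beta h))
      = fps_scale (1 - inverse q ^ 2) (central - series alpha h * series beta h)"
    using V.imaginary_root_product[OF ka(2)]
    unfolding u by (simp add: r_def central_def S.scale_mult_left)
  also have "1 - inverse q ^ 2 = alpha * ?c"
  proof -
    have "alpha * ?c = inverse q * ((q - inverse q) * ((q - inverse q) * inverse (q - inverse q)))"
      by (simp only: alpha_def power2_eq_square mult_minus_left mult_minus_right minus_minus mult.assoc)
    then show ?thesis
      using q q_diff_nonzero by (simp add: right_diff_distrib power2_eq_square)
  qed
  finally have "fps_X * (r * series alpha h * series beta h)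
      = fps_scale ?c (central - series alpha h * series beta h)"
    using nonzero by (simp only: S.scale_scale[symmetric] S.scale_cancel_left simp_thms)
  \<comment> \<open>Adding the constant term \<open>?c\<close> absorbs the summand with the product
    of the two \<open>h\<close> series.\<close>
  moreover have "(fps_scale ?c 1 + fps_X * r) * x * y = fps_scale ?c (x * y) + fps_X * (r * x * y)" for x y
    by (simp only: distrib_right S.scale_mult_left mult_1_left mult.assoc)
  ultimately have "(fps_scale ?c 1 + fps_X * r) * series alpha h * series beta h = fps_scale ?c central"
    by (simp only: S.scale_right_diff_distrib add_diff_cancel_left' add_diff_eq)
  from arg_cong[OF this, of "\<lambda>x. x * kb * ka"]
  have "fps_scale ?c central * kb * ka
      = (fps_scale ?c 1 + fps_X * r) * (series alpha h * (series beta h * kb) * ka)"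
    by (simp only: mult.assoc)
  then have "fps_scale ?c (central * kb * ka) = fps_scale ?c 1 + fps_X * r"
    by (simp only: kb(1) ka(1) S.scale_mult_left mult_1_right)
  then show "f 0 = ?c *s 1" "f (Suc n) = inverse q ^ 2 *s (e n * m 0) - m 0 * e n"
    by (simp_all add: f_def e_def r_def)
qed

end

section \<open>Presented algebras\<close>

lemma scalar_add: "scalar (a + b) = scalar a + scalar b"
  by (simp add: scalar_def single_add)

lemma scalar_mult: "scalar (a * b) = scalar a * scalar b"
  by (simp add: scalar_def mult_single)

lemma scalar_1 [simp]: "scalar 1 = 1"
  by (simp add: scalar_def)

lemma scalar_commute: "x * scalar c = scalar c * x"
proof (induction x rule: Poly_Mapping.update_induct)
  case (update f k a)
  then have "Poly_Mapping.update k a f = f + Poly_Mapping.single k a"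
    by (intro poly_mapping_eqI)
      (auto simp: lookup_update lookup_add lookup_single when_def in_keys_iff)
  then show ?case
    using update by (simp add: distrib_left distrib_right scalar_def mult_single mult.commute)
qed simp

lemma ring_free_algebra_ring: "ring free_algebra_ring"
proof (rule ringI)
  show "abelian_group free_algebra_ring"
    by (rule abelian_groupI)
      (auto simp: free_algebra_ring_def add_ac intro: exI[of _ "- x" for x] left_minus)
  show "Group.monoid free_algebra_ring"
    by (rule monoidI) (auto simp: free_algebra_ring_def mult.assoc)
qed (auto simp: free_algebra_ring_def distrib_left distrib_right)

lemma ideal_relation_ideal: "ideal (relation_ideal rel) free_algebra_ring"
  unfolding relation_ideal_def
  by (rule ring.genideal_ideal[OF ring_free_algebra_ring]) (simp add: free_algebra_ring_def)

lemma
  shows relation_ideal_zero: "0 \<in> relation_ideal rel"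
    and relation_ideal_add: "x \<in> relation_ideal rel \<Longrightarrow> y \<in> relation_ideal rel \<Longrightarrow> x + y \<in> relation_ideal rel"
    and relation_ideal_mult_left: "x \<in> relation_ideal rel \<Longrightarrow> y * x \<in> relation_ideal rel"
proof -
  interpret ideal "relation_ideal rel" free_algebra_ring
    by (rule ideal_relation_ideal)
  show "0 \<in> relation_ideal rel"
    using additive_subgroup.zero_closed[OF is_additive_subgroup] by (simp add: free_algebra_ring_def)
  show "x \<in> relation_ideal rel \<Longrightarrow> y \<in> relation_ideal rel \<Longrightarrow> x + y \<in> relation_ideal rel"
    using additive_subgroup.a_closed[OF is_additive_subgroup, of x y] by (simp add: free_algebra_ring_def)
  show "x \<in> relation_ideal rel \<Longrightarrow> y * x \<in> relation_ideal rel"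
    using I_l_closed[of x y] by (simp add: free_algebra_ring_def)
qed

lemma relation_ideal_uminus: "x \<in> relation_ideal rel \<Longrightarrow> - x \<in> relation_ideal rel"
  using relation_ideal_mult_left[of x rel "-1"] by simp

lemma relation_ideal_base: "rel a b \<Longrightarrow> a - b \<in> relation_ideal rel"
  unfolding relation_ideal_def
  by (rule subsetD[OF ring.genideal_self[OF ring_free_algebra_ring]])
    (auto simp: free_algebra_ring_def)

text \<open>The empty relation presents the free algebra itself; this yields 0 \<noteq> 1 in the
  product algebra below.\<close>

lemma relation_ideal_empty: "relation_ideal (\<lambda>_ _. False) = {0}"
proof -
  have "relation_ideal (\<lambda>_ _. False) \<subseteq> {\<zero>\<^bsub>free_algebra_ring\<^esub>}"
    unfolding relation_ideal_def
    by (rule ring.genideal_minimal[OF ring_free_algebra_ring ring.zeroideal[OF ring_free_algebra_ring]]) simp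
  then show ?thesis
    using relation_ideal_zero by (auto simp: free_algebra_ring_def)
qed

definition coset :: "('f::field, 'g) relations \<Rightarrow> ('f, 'g) free_algebra \<Rightarrow> ('f, 'g) free_algebra set"
  where "coset rel x = relation_ideal rel +>\<^bsub>free_algebra_ring\<^esub> x"

lemma coset_altdef: "coset rel x = (\<lambda>i. i + x) ` relation_ideal rel"
  by (auto simp: coset_def a_r_coset_def r_coset_def free_algebra_ring_def)

lemma coset_eq_iff: "coset rel x = coset rel y \<longleftrightarrow> x - y \<in> relation_ideal rel"
proof
  assume "coset rel x = coset rel y"
  moreover have "x \<in> coset rel x"
    unfolding coset_altdef using relation_ideal_zero by (force intro: image_eqI[of _ _ 0])
  ultimately show "x - y \<in> relation_ideal rel"
    by (auto simp: coset_altdef)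
next
  have le: "coset rel x \<subseteq> coset rel y" if "x - y \<in> relation_ideal rel" for x y
    unfolding coset_altdef
  proof clarify
    fix i
    assume "i \<in> relation_ideal rel"
    then have "i + (x - y) \<in> relation_ideal rel"
      using that by (rule relation_ideal_add)
    then show "i + x \<in> (\<lambda>i. i + y) ` relation_ideal rel"
      by (auto intro!: image_eqI[of _ _ "i + (x - y)"])
  qed
  assume "x - y \<in> relation_ideal rel"
  moreover from this have "y - x \<in> relation_ideal rel"
    using relation_ideal_uminus by fastforce
  ultimately show "coset rel x = coset rel y"
    using le by blast
qed

lemma presented_algebra_simps:
  fixes rel :: "('f::field, 'g) relations"
  shows "carrier (presented_algebra rel) = range (coset rel)"
  "coset rel x \<otimes>\<^bsub>presented_algebra rel\<^esub> coset rel y = coset rel (x * y)"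
  "coset rel x \<oplus>\<^bsub>presented_algebra rel\<^esub> coset rel y = coset rel (x + y)"
  "\<one>\<^bsub>presented_algebra rel\<^esub> = coset rel 1"
  "\<zero>\<^bsub>presented_algebra rel\<^esub> = coset rel 0"
  "c \<odot>\<^bsub>presented_algebra rel\<^esub> coset rel x = coset rel (scalar c * x)"
proof -
  interpret ideal "relation_ideal rel" free_algebra_ring
    by (rule ideal_relation_ideal)
  note defs = presented_algebra_def ring.extend_def module.fields_def FactRing_def
  have sel: "carrier free_algebra_ring = UNIV"
    "a \<otimes>\<^bsub>free_algebra_ring\<^esub> b = a * b" "a \<oplus>\<^bsub>free_algebra_ring\<^esub> b = a + b"
    "\<one>\<^bsub>free_algebra_ring\<^esub> = 1" "\<zero>\<^bsub>free_algebra_ring\<^esub> = 0"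
    for a b :: "('f, 'g) free_algebra"
    by (simp_all add: free_algebra_ring_def)
  show "carrier (presented_algebra rel) = range (coset rel)"
    by (auto simp: defs A_RCOSETS_def' coset_def sel)
  show "coset rel x \<otimes>\<^bsub>presented_algebra rel\<^esub> coset rel y = coset rel (x * y)"
    using rcoset_mult_add[of x y] by (simp add: defs coset_def sel)
  show "coset rel x \<oplus>\<^bsub>presented_algebra rel\<^esub> coset rel y = coset rel (x + y)"
    using a_rcos_sum[of x y] by (simp add: defs coset_def sel)
  show "\<one>\<^bsub>presented_algebra rel\<^esub> = coset rel 1"
    by (simp add: defs coset_def sel)
  show "\<zero>\<^bsub>presented_algebra rel\<^esub> = coset rel 0"
    by (simp add: defs coset_altdef)
  \<comment> \<open>The scalar multiple of a coset is a union over its representatives, all of which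
    contribute the same coset.\<close>
  have "coset rel (scalar c * y) = coset rel (scalar c * x)" if "y \<in> coset rel x" for y
  proof -
    have "y - x \<in> relation_ideal rel"
      using that by (auto simp: coset_altdef)
    then show ?thesis
      using relation_ideal_mult_left[of "y - x" rel "scalar c"]
      by (simp add: coset_eq_iff right_diff_distrib)
  qed
  moreover have "x \<in> coset rel x"
    unfolding coset_altdef using relation_ideal_zero by (force intro: image_eqI[of _ _ 0])
  ultimately have "(\<Union>y\<in>coset rel x. coset rel (scalar c * y)) = coset rel (scalar c * x)"
    by (intro UN_constant_eq ballI)
  then show "c \<odot>\<^bsub>presented_algebra rel\<^esub> coset rel x = coset rel (scalar c * x)"
    by (simp add: defs coset_def)
qed

lemma
  assumes "coset rel x = coset rel x'" "coset rel y = coset rel y'"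
  shows coset_add_cong: "coset rel (x + y) = coset rel (x' + y')"
    and coset_mult_cong: "coset rel (x * y) = coset rel (x' * y')"
    and coset_diff_cong: "coset rel (x - y) = coset rel (x' - y')"
proof -
  have add: "coset rel (a + b) = coset rel (a' + b')"
    if "coset rel a = coset rel a'" "coset rel b = coset rel b'" for a a' b b'
    by (subst (1 2) presented_algebra_simps(3)[symmetric]) (simp only: that)
  have mult: "coset rel (a * b) = coset rel (a' * b')"
    if "coset rel a = coset rel a'" "coset rel b = coset rel b'" for a a' b b'
    by (subst (1 2) presented_algebra_simps(2)[symmetric]) (simp only: that)
  show "coset rel (x + y) = coset rel (x' + y')" "coset rel (x * y) = coset rel (x' * y')"
    using assms by (rule add, rule mult)
  show "coset rel (x - y) = coset rel (x' - y')"
    using add[OF assms(1) mult[OF refl assms(2), of "- 1"]] by simp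
qed

lemma coset_uminus_cong: "coset rel x = coset rel x' \<Longrightarrow> coset rel (- x) = coset rel (- x')"
  using coset_diff_cong[of rel 0 0 x x'] by simp

lemma ring_presented_algebra: "ring (presented_algebra rel)"
proof (rule ringI)
  show "abelian_group (presented_algebra rel)"
  proof (rule abelian_groupI)
    fix x
    assume "x \<in> carrier (presented_algebra rel)"
    then obtain a where "x = coset rel a"
      by (auto simp: presented_algebra_simps)
    then show "\<exists>y\<in>carrier (presented_algebra rel). y \<oplus>\<^bsub>presented_algebra rel\<^esub> x = \<zero>\<^bsub>presented_algebra rel\<^esub>"
      by (intro bexI[of _ "coset rel (- a)"]) (simp_all add: presented_algebra_simps)
  qed (auto simp: presented_algebra_simps add_ac)
  show "Group.monoid (presented_algebra rel)"
    by (rule monoidI) (auto simp: presented_algebra_simps mult.assoc)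
qed (auto simp: presented_algebra_simps distrib_left distrib_right)

\<comment> \<open>Below, transfer is to pass from the product to families of representatives,
  leaving free algebra elements intact.\<close>
lifting_forget poly_mapping.lifting

text \<open>The product of all presented algebras over given scalars and generators is a type (a single
  presented algebra is not, since it depends on the relations), so that the library of formal power
  series applies. Being indexed by all relations, it contains the free algebra and is not trivial.\<close>

quotient_type (overloaded) ('f, 'g) algebra_product =
  "('f::field, 'g) relations \<Rightarrow> ('f, 'g) free_algebra" /
  "\<lambda>x y. \<forall>rel. coset rel (x rel) = coset rel (y rel)"
  by (rule equivpI) (auto intro!: reflpI sympI transpI)

instantiation algebra_product :: (field, type) ring_1
begin

lift_definition zero_algebra_product :: "('a, 'b) algebra_product" is "\<lambda>_. 0" .

lift_definition one_algebra_product :: "('a, 'b) algebra_product" is "\<lambda>_. 1" .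

lift_definition plus_algebra_product ::
    "('a, 'b) algebra_product \<Rightarrow> ('a, 'b) algebra_product \<Rightarrow> ('a, 'b) algebra_product"
  is "\<lambda>x y rel. x rel + y rel"
  by (auto intro!: coset_add_cong)

lift_definition times_algebra_product ::
    "('a, 'b) algebra_product \<Rightarrow> ('a, 'b) algebra_product \<Rightarrow> ('a, 'b) algebra_product"
  is "\<lambda>x y rel. x rel * y rel"
  by (auto intro!: coset_mult_cong)

lift_definition uminus_algebra_product :: "('a, 'b) algebra_product \<Rightarrow> ('a, 'b) algebra_product"
  is "\<lambda>x rel. - x rel"
  by (auto intro!: coset_uminus_cong)

lift_definition minus_algebra_product ::
    "('a, 'b) algebra_product \<Rightarrow> ('a, 'b) algebra_product \<Rightarrow> ('a, 'b) algebra_product"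
  is "\<lambda>x y rel. x rel - y rel"
  by (auto intro!: coset_diff_cong)

instance
proof
  show "0 \<noteq> (1 :: ('a, 'b) algebra_product)"
  proof (transfer, rule notI)
    assume *: "\<forall>rel. coset rel 0 = coset rel (1 :: ('a, 'b) free_algebra)"
    from *[rule_format, of "\<lambda>_ _. False"] show False
      by (simp add: coset_eq_iff relation_ideal_empty)
  qed
qed (transfer; simp add: algebra_simps)+

end

lift_definition product_scale :: "'f \<Rightarrow> ('f::field, 'g) algebra_product \<Rightarrow> ('f, 'g) algebra_product"
  is "\<lambda>c x rel. scalar c * x rel"
  by (auto intro!: coset_mult_cong)

lemma assoc_algebra_product: "assoc_algebra product_scale"
proof
  fix c :: 'a and x y :: "('a, 'b) algebra_product"
  show "x * product_scale c y = product_scale c (x * y)"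
    by transfer (simp add: scalar_commute flip: mult.assoc)
qed (transfer; simp add: scalar_add scalar_mult distrib_left distrib_right mult.assoc)+

text \<open>The projection to one factor, a unital homomorphism along which identities in the
  product descend.\<close>

lift_definition component ::
    "('f::field, 'g) relations \<Rightarrow> ('f, 'g) algebra_product \<Rightarrow> ('f, 'g) free_algebra set"
  is "\<lambda>rel x. coset rel (x rel)"
  by simp

text \<open>Not unital: all other components are zero. The alternating generators remain subject to their
  relations in those components, because both sides of each relation vanish at zero.\<close>

lift_definition inject ::
    "('f::field, 'g) relations \<Rightarrow> ('f, 'g) free_algebra \<Rightarrow> ('f, 'g) algebra_product"
  is "\<lambda>rel x rel'. if rel' = rel then x else 0" .

lemma inject_simps:
  "inject rel (x + y) = inject rel x + inject rel y"
  "inject rel (x - y) = inject rel x - inject rel y"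
  "inject rel (x * y) = inject rel x * inject rel y"
  "inject rel (scalar c * x) = product_scale c (inject rel x)"
  "inject rel 0 = 0"
  by (transfer; auto)+

lemma inject_eq:
  assumes "rel a b"
  shows "inject rel a = inject rel b"
proof -
  have "coset rel a = coset rel b"
    by (simp add: coset_eq_iff relation_ideal_base assms)
  then show ?thesis
    by transfer simp
qed

lemma component_inject: "component rel (inject rel x) = coset rel x"
  by transfer simp

lemma carrier_presented_algebra: "carrier (presented_algebra rel) = range (component rel)"
proof -
  have "range (component rel) = range (coset rel)"
    by (auto simp: component_inject[symmetric]) (transfer, auto)
  then show ?thesis
    by (simp add: presented_algebra_simps)
qed

lemma component_simps:
  "component rel (x + y) = component rel x \<oplus>\<^bsub>presented_algebra rel\<^esub> component rel y"
  "component rel (x * y) = component rel x \<otimes>\<^bsub>presented_algebra rel\<^esub> component rel y"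
  "component rel (product_scale c x) = c \<odot>\<^bsub>presented_algebra rel\<^esub> component rel x"
  "component rel 1 = \<one>\<^bsub>presented_algebra rel\<^esub>"
  "component rel 0 = \<zero>\<^bsub>presented_algebra rel\<^esub>"
  by (transfer; simp add: presented_algebra_simps)+

lemma component_minus:
  "component rel (x - y) = component rel x \<ominus>\<^bsub>presented_algebra rel\<^esub> component rel y"
proof -
  interpret ring "presented_algebra rel"
    by (rule ring_presented_algebra)
  have "component rel (x - y) \<oplus>\<^bsub>presented_algebra rel\<^esub> component rel y = component rel x"
    by (simp flip: component_simps)
  moreover have "component rel z \<in> carrier (presented_algebra rel)" for z
    by (simp add: carrier_presented_algebra)
  ultimately show ?thesis
    by (metis add.inv_solve_right a_minus_def)
qed

lemma component_sum:
  assumes "finite I"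
  shows "component rel (\<Sum>i\<in>I. f i) = (\<Oplus>\<^bsub>presented_algebra rel\<^esub>i\<in>I. component rel (f i))"
proof -
  interpret ring "presented_algebra rel"
    by (rule ring_presented_algebra)
  show ?thesis
    using assms
    by (induction I rule: finite_induct) (simp_all add: component_simps carrier_presented_algebra)
qed

section \<open>Projection of generating functions\<close>

definition component_series ::
    "('f::field, 'g) relations \<Rightarrow> ('f, 'g) algebra_product fps \<Rightarrow> nat \<Rightarrow> ('f, 'g) free_algebra set"
  where "component_series rel f = (\<lambda>n. component rel (fps_nth f n))"

lemma component_series_simps:
  "component_series rel (f * g)
    = component_series rel f \<otimes>\<^bsub>series_algebra (presented_algebra rel)\<^esub> component_series rel g"
  "component_series rel 1 = \<one>\<^bsub>series_algebra (presented_algebra rel)\<^esub>"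
  by (simp_all add: component_series_def series_algebra_def fps_mult_nth component_simps
      component_sum atLeast0AtMost if_distrib[of "component rel"] cong: if_cong)

text \<open>Every series over a presented algebra lifts to the product, so the monoid laws of
  \<open>series_algebra\<close> are inherited from power series.\<close>

lemma carrier_series_algebra:
  "carrier (series_algebra (presented_algebra rel)) = range (component_series rel)"
proof -
  have "a \<in> range (component_series rel)" if "\<And>n. a n \<in> range (component rel)" for a
  proof
    show "a = component_series rel (Abs_fps (\<lambda>n. inv_into UNIV (component rel) (a n)))"
      using f_inv_into_f[OF that] by (simp add: component_series_def)
  qed simp
  then show ?thesis
    by (auto simp: series_algebra_def carrier_presented_algebra component_series_def)
qed

text \<open>The projection preserves two-sided inverses, and these are unique in a monoid.\<close>

lemma component_series_inverse:
  assumes "f * k = 1" "k * f = 1"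
  shows "inv\<^bsub>series_algebra (presented_algebra rel)\<^esub> component_series rel f = component_series rel k"
proof -
  interpret S: monoid "series_algebra (presented_algebra rel)"
    by (rule monoidI)
      (auto simp: carrier_series_algebra mult.assoc simp flip: component_series_simps)
  show ?thesis
    using assms
    by (intro S.inv_char) (simp_all add: carrier_series_algebra flip: component_series_simps)
qed

section \<open>The alternating central extension\<close>

context
  fixes q :: "'f::field"
begin

definition pWm :: "nat \<Rightarrow> ('f, alt_gen) algebra_product"
  where "pWm k = inject (alt_rel q) (fW (- int k))"

definition pWp :: "nat \<Rightarrow> ('f, alt_gen) algebra_product"
  where "pWp k = inject (alt_rel q) (fW (int k + 1))"

text \<open>At 0 this is the unit of the product and not \<open>inject\<close> of 1, because
  \<open>inject\<close> is not unital.\<close>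

definition pG :: "nat \<Rightarrow> ('f, alt_gen) algebra_product"
  where "pG n = (case n of 0 \<Rightarrow> 1 | Suc k \<Rightarrow> inject (alt_rel q) (gen (GenG k)))"

definition pGt :: "nat \<Rightarrow> ('f, alt_gen) algebra_product"
  where "pGt n = (case n of 0 \<Rightarrow> 1 | Suc k \<Rightarrow> inject (alt_rel q) (gen (GenGt k)))"

lemma component_generators:
  "component (alt_rel q) (pWm k) = W q (- int k)"
  "component (alt_rel q) (pWp k) = W q (int k + 1)"
  "component (alt_rel q) (pG k) = G q k"
  "component (alt_rel q) (pGt k) = Gt q k"
  by (simp_all add: pWm_def pWp_def pG_def pGt_def component_inject
      W_def G_def Gt_def presented_gen_def
      coset_def component_simps Uq_def split: nat.split)

lemma alternating_family_product:
  assumes "q \<noteq> 0" "q\<^sup>2 \<noteq> 1" "q\<^sup>2 \<noteq> - 1"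
  shows "alternating_family product_scale q pWm pWp pG pGt"
proof -
  \<comment> \<open>The unfolding is staged so that factors \<open>scalar c\<close> become scalar
    multiples before products are split.\<close>
  note rel = alt_rel.intros[where q = q, THEN inject_eq[where rel = "alt_rel q"],
      unfolded comm_def qcomm_def inject_simps(1,2), unfolded inject_simps(4), unfolded inject_simps]
  have powi: "q powi (-2) = inverse q ^ 2"
    by (simp add: power_int_minus power_inverse)
  have index: "- int k - 1 = - int (Suc k)" for k
    by simp
  have "inject (alt_rel q) (fW 0) = pWm 0" "inject (alt_rel q) (fW 1) = pWp 0"
    "inject (alt_rel q) (fW (- int k)) = pWm k" "inject (alt_rel q) (fW (int k + 1)) = pWp k"
    "inject (alt_rel q) (fW (- int k - 1)) = pWm (Suc k)"
    "inject (alt_rel q) (fW (int k + 2)) = pWp (Suc k)"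
    "inject (alt_rel q) (fG (k + 1)) = pG (Suc k)" "inject (alt_rel q) (fGt (k + 1)) = pGt (Suc k)" for k
    unfolding index by (simp_all add: pWm_def pWp_def pG_def pGt_def algebra_simps)
  note rel' = rel[unfolded this powi]
  have "pG 0 = 1" "pGt 0 = 1"
    by (simp_all add: pG_def pGt_def)
  then show ?thesis
    by (intro alternating_family.intro assoc_algebra_product alternating_family_axioms.intro)
      (rule assms rel' | assumption)+
qed

text \<open>The recursion determines the sequence, and the projection respects each operation in
  it.\<close>

lemma component_E_alpha0:
  assumes "f 0 = pWm 0"
    and "\<And>n. f (Suc n) = product_scale (inverse (q + inverse q))
      ((product_scale (q powi (-2)) (pWp 0 * pWm 0) - pWm 0 * pWp 0) * f n
        - f n * (product_scale (q powi (-2)) (pWp 0 * pWm 0) - pWm 0 * pWp 0))"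
  shows "component (alt_rel q) (f n) = E_minus q n"
  unfolding E_minus_def
  by (induction n)
    (simp_all add: assms E_delta1_def component_simps component_minus component_generators Uq_def)

lemma component_E_alpha1:
  assumes "f 0 = pWp 0"
    and "\<And>n. f (Suc n) = product_scale (inverse (q + inverse q))
      (f n * (product_scale (q powi (-2)) (pWp 0 * pWm 0) - pWm 0 * pWp 0)
        - (product_scale (q powi (-2)) (pWp 0 * pWm 0) - pWm 0 * pWp 0) * f n)"
  shows "component (alt_rel q) (f n) = E_plus q n"
  unfolding E_plus_def
  by (induction n)
    (simp_all add: assms E_delta1_def component_simps component_minus component_generators Uq_def)

lemma component_series_dilate:
  "component_series (alt_rel q) (assoc_algebra.series product_scale c a)
    = dilate (Uq q) c (\<lambda>n. component (alt_rel q) (a n))"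
  by (simp add: component_series_def dilate_def assoc_algebra.series_nth[OF assoc_algebra_product]
      component_simps Uq_def)

end

lemma inverse_xi: "inverse (xi q) = - (inverse q ^ 2 * (q - inverse q) ^ 2)"
  by (simp add: xi_def power_int_minus power_inverse)

text \<open>The arguments x/q and q x of the two factors produce the powers of q in
  \<open>Zv\<close>.\<close>

lemma powi_split:
  fixes q :: "'f::field"
  assumes "k \<le> n" "q \<noteq> 0"
  shows "(inverse q * x) ^ k * (q * x) ^ (n - k) = x ^ n * q powi (int n - 2 * int k)"
proof -
  have "q powi (int n - 2 * int k) = q powi (int (n - k)) * q powi (- int k)"
    using assms by (simp flip: power_int_add)
  also have "\<dots> = q ^ (n - k) * inverse q ^ k"
    by (simp add: power_int_minus power_inverse)
  finally have "x ^ n * q powi (int n - 2 * int k) = x ^ (k + (n - k)) * (q ^ (n - k) * inverse q ^ k)"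
    using assms by simp
  then show ?thesis
    by (simp only: power_mult_distrib power_add mult_ac)
qed

lemma component_central:
  fixes q :: "'f::field"
  assumes "q \<noteq> 0" "q\<^sup>2 \<noteq> 1" "q\<^sup>2 \<noteq> - 1"
  shows "component_series (alt_rel q)
      (alternating_family.central product_scale q (pWm q) (pWp q) (pG q) (pGt q))
    = dilate (Uq q) (inverse (xi q)) (Zv q)"
proof
  interpret alternating_family product_scale q "pWm q" "pWp q" "pG q" "pGt q"
    using assms by (rule alternating_family_product)
  interpret S: assoc_algebra fps_scale
    by (rule assoc_algebra_fps)
  let ?x = "inverse (xi q)"
  have ab: "beta = inverse q * ?x" "alpha = q * ?x"
    using assms by (simp_all add: beta_def alpha_def inverse_xi power2_eq_square power3_eq_cube)
  fix n
  show "component_series (alt_rel q) central n = dilate (Uq q) ?x (Zv q) n"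
  proof (cases n)
    case 0
    then show ?thesis
      by (simp add: component_series_def dilate_def central_def S.scale_mult_left Zv_def g0 h0 Uq_def
          flip: component_simps)
  next
    case (Suc l)
    define Z where "Z = (\<Sum>k=0..n. product_scale (q powi (int n - 2 * int k)) (pG q k * pGt q (n - k)))
      - product_scale q (\<Sum>k=0..l. product_scale (q powi (int n - 1 - 2 * int k)) (pWm q k * pWp q (l - k)))"
    have 1: "fps_nth (series beta (pG q) * series alpha (pGt q)) n
        = product_scale (?x ^ n)
            (\<Sum>k=0..n. product_scale (q powi (int n - 2 * int k)) (pG q k * pGt q (n - k)))"
      unfolding fps_mult_nth scale_sum_right
    proof (rule sum.cong)
      fix k
      assume "k \<in> {0..n}"
      then show "fps_nth (series beta (pG q)) k * fps_nth (series alpha (pGt q)) (n - k)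
          = product_scale (?x ^ n) (product_scale (q powi (int n - 2 * int k)) (pG q k * pGt q (n - k)))"
        using powi_split[of k n q ?x] assms
        by (simp add: ab scale_mult_left scale_mult_right mult.commute)
    qed simp
    have 2: "fps_nth (series beta (pWm q) * series alpha (pWp q)) l
        = product_scale (?x ^ l)
            (\<Sum>k=0..l. product_scale (q powi (int n - 1 - 2 * int k)) (pWm q k * pWp q (l - k)))"
      unfolding fps_mult_nth scale_sum_right
    proof (rule sum.cong)
      fix k
      assume "k \<in> {0..l}"
      then show "fps_nth (series beta (pWm q)) k * fps_nth (series alpha (pWp q)) (l - k)
          = product_scale (?x ^ l) (product_scale (q powi (int n - 1 - 2 * int k)) (pWm q k * pWp q (l - k)))"
        using powi_split[of k l q ?x] assms
        by (simp add: Suc ab scale_mult_left scale_mult_right mult.commute)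
    qed simp
    \<comment> \<open>Since alpha = q x, the second product gets the factor q of \<open>Zv\<close>
      and its power x^l becomes x^n.\<close>
    have "fps_nth central n = product_scale (?x ^ n) Z"
    proof -
      have "fps_nth central n = fps_nth (series beta (pG q) * series alpha (pGt q)) n
          - product_scale alpha (fps_nth (series beta (pWm q) * series alpha (pWp q)) l)"
        by (simp add: central_def S.scale_mult_left Suc)
      then show ?thesis
        unfolding 1 2 Z_def by (simp add: scale_right_diff_distrib ab Suc mult_ac)
    qed
    moreover have "component (alt_rel q) Z = Zv q n"
    proof -
      let ?w = "\<lambda>i. inject (alt_rel q) (fW i)"
      \<comment> \<open>With n = l + 1 and k \<le> l, the index n - k is positive and corresponds to
        \<open>pWp\<close> at l - k.\<close>
      have w: "pWp q (l - k) = ?w (int n - int k)" if "k \<in> {0..l}" for k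
        using that by (simp add: pWp_def Suc of_nat_diff algebra_simps)
      have "(\<Sum>k=0..l. product_scale (q powi (int n - 1 - 2 * int k)) (pWm q k * pWp q (l - k)))
          = (\<Sum>k=0..l. product_scale (q powi (int n - 1 - 2 * int k)) (pWm q k * ?w (int n - int k)))"
        by (intro sum.cong refl) (simp only: w)
      moreover have "component (alt_rel q) (?w i) = W q i" for i
        by (simp add: component_inject W_def presented_gen_def coset_def)
      moreover have "Zv q n =
        (\<Oplus>\<^bsub>Uq q\<^esub>k\<in>{0..n}. q powi (int n - 2 * int k) \<odot>\<^bsub>Uq q\<^esub> (G q k \<otimes>\<^bsub>Uq q\<^esub> Gt q (n - k)))
         \<ominus>\<^bsub>Uq q\<^esub> q \<odot>\<^bsub>Uq q\<^esub> (\<Oplus>\<^bsub>Uq q\<^esub>k\<in>{0..l}. q powi (int n - 1 - 2 * int k) \<odot>\<^bsub>Uq q\<^esub>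
            (W q (- int k) \<otimes>\<^bsub>Uq q\<^esub> W q (int n - int k)))"
        by (simp add: Zv_def Suc)
      ultimately show ?thesis
        unfolding Z_def
        by (simp only: component_minus component_simps component_sum component_generators Uq_def
            finite_atLeastAtMost)
    qed
    ultimately show ?thesis
      by (simp add: component_series_def dilate_def component_simps Uq_def)
  qed
qed

theorem theorem12p2:
  fixes q :: "'f::field"
  assumes "q \<noteq> 0"
    and "\<forall>n::nat. n > 0 \<longrightarrow> q ^ n \<noteq> 1"
  shows
    "let U = Uq q; S = series_algebra U; \<xi> = xi q;
         c = inverse q * inverse \<xi>; d = q * inverse \<xi>
     in E_minus q = dilate U c (W_minus q) \<otimes>\<^bsub>S\<^esub> inv\<^bsub>S\<^esub> (dilate U c (Gt q)) \<and>
        E_plus q = dilate U d (W_plus q) \<otimes>\<^bsub>S\<^esub> inv\<^bsub>S\<^esub> (dilate U d (Gt q)) \<and>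
        E_series q = (- inverse (q - inverse q)) \<odot>\<^bsub>S\<^esub>
          (dilate U (inverse \<xi>) (Zv q)
             \<otimes>\<^bsub>S\<^esub> inv\<^bsub>S\<^esub> (dilate U c (Gt q)) \<otimes>\<^bsub>S\<^esub> inv\<^bsub>S\<^esub> (dilate U d (Gt q)))"
proof -
  have q: "q \<noteq> 0" "q\<^sup>2 \<noteq> 1" "q\<^sup>2 \<noteq> - 1"
  proof -
    \<comment> \<open>Both exclusions follow from q^4 \<noteq> 1.\<close>
    have "(q\<^sup>2)\<^sup>2 \<noteq> 1"
      using assms(2)[rule_format, of 4] by (simp flip: power_mult)
    then show "q\<^sup>2 \<noteq> 1" "q\<^sup>2 \<noteq> - 1"
      by (metis power_one, metis power2_minus power_one)
  qed (rule assms)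
  interpret alternating_family product_scale q "pWm q" "pWp q" "pG q" "pGt q"
    using q by (rule alternating_family_product)
  let ?A = "presented_algebra (alt_rel q)" and ?x = "inverse (xi q)"
  let ?S = "series_algebra ?A"
  note comp = component_series_dilate[of q, unfolded Uq_def]
  have ab: "beta = inverse q * ?x" "alpha = q * ?x"
    using q by (simp_all add: beta_def alpha_def inverse_xi power2_eq_square power3_eq_cube)
  obtain kb where kb: "series beta (pGt q) * kb = 1" "kb * series beta (pGt q) = 1"
    using fps_invertible[of "series beta (pGt q)"] by (auto simp: h0)
  obtain ka where ka: "series alpha (pGt q) * ka = 1" "ka * series alpha (pGt q) = 1"
    using fps_invertible[of "series alpha (pGt q)"] by (auto simp: h0)
  have Gt: "dilate ?A c (Gt q) = component_series (alt_rel q) (series c (pGt q))" for c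
    by (simp add: comp component_generators)
  have inv_Gt: "inv\<^bsub>?S\<^esub> (dilate ?A beta (Gt q)) = component_series (alt_rel q) kb"
    "inv\<^bsub>?S\<^esub> (dilate ?A alpha (Gt q)) = component_series (alt_rel q) ka"
    by (simp_all only: Gt component_series_inverse[OF kb] component_series_inverse[OF ka])
  have W: "dilate ?A beta (W_minus q) = component_series (alt_rel q) (series beta (pWm q))"
    "dilate ?A alpha (W_plus q) = component_series (alt_rel q) (series alpha (pWp q))"
    by (simp_all add: comp component_generators W_minus_def W_plus_def)
  have Z: "dilate ?A ?x (Zv q) = component_series (alt_rel q) central"
    using component_central[OF q] by (simp add: Uq_def)
  have delta1: "delta1 = product_scale (q powi (-2)) (pWp q 0 * pWm q 0) - pWm q 0 * pWp q 0"
    by (simp add: delta1_def power_int_minus power_inverse)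
  have minus: "E_minus q = dilate ?A beta (W_minus q) \<otimes>\<^bsub>?S\<^esub> inv\<^bsub>?S\<^esub> (dilate ?A beta (Gt q))"
    unfolding inv_Gt W component_series_simps(1)[symmetric]
    using component_E_alpha0[of _ q, OF minus_quotient[OF kb, unfolded delta1]]
    by (simp add: component_series_def)
  have plus: "E_plus q = component_series (alt_rel q) (series alpha (pWp q) * ka)"
    using component_E_alpha1[of _ q, OF plus_quotient[OF ka, unfolded delta1]]
    by (simp add: component_series_def)
  have "E_series q n = component (alt_rel q)
      (fps_nth (fps_scale (- inverse (q - inverse q)) (central * kb * ka)) n)" for n
  proof (cases n)
    case 0
    then show ?thesis
      by (simp only: imaginary_quotient(1)[OF kb ka] E_series_def E_delta.simps component_simps Uq_def)
  next
    case (Suc l)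
    \<comment> \<open>\<open>E_delta\<close> at \<open>Suc l\<close> is built from
      \<open>E_alpha1\<close> at \<open>l\<close>, so the identity for \<open>E_plus\<close> enters
      here.\<close>
    have "component (alt_rel q) (fps_nth (series alpha (pWp q) * ka) l) = E_plus q l"
      by (simp add: plus component_series_def)
    then show ?thesis
      unfolding Suc imaginary_quotient(2)[OF kb ka]
      by (simp add: E_series_def component_simps component_minus component_generators Uq_def
          E_plus_def power_int_minus power_inverse)
  qed
  then have "E_series q = (- inverse (q - inverse q)) \<odot>\<^bsub>?S\<^esub>
      component_series (alt_rel q) (central * kb * ka)"
    by (simp add: fun_eq_iff component_series_def series_algebra_def component_simps
        del: scale_minus_left)
  then have "E_series q = (- inverse (q - inverse q)) \<odot>\<^bsub>?S\<^esub> (dilate ?A ?x (Zv q)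
      \<otimes>\<^bsub>?S\<^esub> inv\<^bsub>?S\<^esub> (dilate ?A beta (Gt q)) \<otimes>\<^bsub>?S\<^esub> inv\<^bsub>?S\<^esub> (dilate ?A alpha (Gt q)))"
    by (simp only: inv_Gt Z component_series_simps)
  then show ?thesis
    using minus plus
    by (simp add: Let_def Uq_def inv_Gt W component_series_simps flip: ab)
qed

end
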